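(* Let $m>1$ be an integer, let $\mathbb F$ be an algebraically closed field of characteristic $p=2$, and let $\lambda=(\lambda_1,\dots,\lambda_{2m+1})\in\mathbb F^{2m+1}$. Let $A_m^{[2]}$ and $\overline e^i_j$ be as in the context. (1) If $\lambda_{2m+1}=0$, then a basis of $H^2_*(\mathfrak h_m^\lambda,\mathfrak h_m^\lambda)$ is given by the cohomology classes of $A_m^{[2]}\cup\{(0,\overline e^{2m+1}_{2m+1})\}$. (2) If $\lambda_{2m+1}\ne0$, then $H^2_*(\mathfrak h_m^\lambda,\mathfrak h_m^\lambda)\cong H^2(\mathfrak h_m,\mathfrak h_m)$, and a basis of $H^2_*(\mathfrak h_m^\lambda,\mathfrak h_m^\lambda)$ is given by the cohomology classes of $A_m^{[2]}$.
   Context: **Heisenberg algebra.** $\mathfrak h_m$ is the Lie algebra over $\mathbb F$ with basis $e_1,\dots,e_{2m+1}$ whose only non-vanishing brackets of basis vectors are $[e_i,e_{m+i}]=e_{2m+1}$ for $1\le i\le m$ (and those forced by antisymmetry). $\mathfrak h_m^\lambda$ is $\mathfrak h_m$ with the $[2]$-map determined by $e_i^{[2]}=\lambda_ie_{2m+1}$; for $g=\sum a_ie_i$, $g^{[2]}=\big(\sum_{i=1}^{2m+1}a_i^2\lambda_i+\sum_{j=1}^m a_ja_{m+j}\big)e_{2m+1}$. Put $i'=i+m$ for $1\le i\le m$, $i'=i-m$ for $m+1\le i\le 2m$, and $(2m+1)'=2m+1$. **Ordinary cohomology.** $C^q=\mathrm{Hom}(\wedge^q\mathfrak h_m,\mathfrak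 h_m)$ with Chevalley–Eilenberg differentials: $d^1(\psi)(g\wedge h)=[g,\psi(h)]-[h,\psi(g)]-\psi([g,h])$; $d^2(\phi)(g\wedge h\wedge k)=[g,\phi(h\wedge k)]-[h,\phi(g\wedge k)]+[k,\phi(g\wedge h)]-\phi([g,h]\wedge k)+\phi([g,k]\wedge h)-\phi([h,k]\wedge g)$; $H^2(\mathfrak h_m,\mathfrak h_m)=\ker d^2/\mathrm{im}\,d^1$. **Restricted cohomology ($p=2$).** For $\phi\in C^2$, a map $\omega:\mathfrak h_m\to\mathfrak h_m$ is $\phi$-compatible if $\omega(ag)=a^2\omega(g)$ and $\omega(g+h)=\omega(g)+\omega(h)+\phi(g\wedge h)$ for all $a\in\mathbb F$, $g,h\in\mathfrak h_m$. Put $C^1_*=C^1$, $C^2_*=\{(\phi,\omega):\phi\in C^2,\ \omega\ \phi\text{-compatible}\}$. For $\psi\in C^1$: $\mathrm{ind}^1(\psi)(g)=\psi(g^{[2]})-[g,\psi(g)]$ and $d^1_*(\psi)=(d^1\psi,\mathrm{ind}^1(\psi))$. For $(\phi,\omega)\in C^2_*$: $$\mathrm{ind}^2(\phi,\omega)(g,h)=\phi(g\wedge h^{[2]})+[g,\omega(h)]+\phi(h\wedge[h,g])+[h,\phi(h\wedge g)]$$ and $d^2_*(\phi,\omega)=(d^2\phi,\mathrm{ind}^2(\phi,\omega))$. Then $H^2_*(\mathfrak h_m^\lambda,\mathfrak h_m^\lambda)=\ker d^2_*/\mathrm{im}\,d^1_*$. **Notation.** $\widetilde\phi$ is the unique $\phi$-compatible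 map with $\widetilde\phi(e_i)=0$ for all $i$; $\widetilde e^{ij}_k$ means $\widetilde{e^{ij}_k}$. $\overline e^i_j\big(\sum_k a_ke_k\big)=a_i^2e_j$. $e^{i,j}_k=e^{ij}_k$ is the alternating bilinear map sending $(e_i,e_j)$ to $e_k$ and vanishing on pairs of basis vectors $(e_r,e_s)$ with $\{r,s\}\ne\{i,j\}$ (so $e^{j,i}_k=-e^{i,j}_k$). **The set $A_m$** of 2-cocycles (whose classes form a basis of $H^2(\mathfrak h_m,\mathfrak h_m)$) is the union of - $\{e^{ij}_{i'},\,e^{ij}_{j'}\mid 1\le i<j\le 2m\}$; - $\{e^{i,j'}_{j'}+e^{j,j'}_{i'},\ e^{ij}_j+e^{j,j'}_{i'}\mid 1\le i\ne j\le m\text{ or }m+1\le i\neq j\le 2m\}$; - $\{e^{kj}_{i'}+e^{ij}_{k'},\ e^{ki}_{j'}-e^{ij}_{k'}\mid 1\le k<i<j\le m\text{ or }m+1\le i<j<k\le 2m\}$; - $\{e^{i,k'}_{j'}-e^{ij}_k,\ e^{j,k'}_{i'}+e^{ij}_k\mid k\ne i,j,\text{ and either }1\le i<j\le m,\ 1\le k\le m,\text{ or }m+1\le i<j\le 2m,\ m+1\le k\le 2m\}$. **The set $A_m^{[2]}$** is $$\{(e^{ij}_{i'},\widetilde e^{ij}_{i'}+\overline e^i_{j'}),\ (e^{ij}_{j'},\widetilde e^{ij}_{j'}+\overline e^j_{i'})\mid 1\le i<j\le 2m\}\ \cup\ \{(\phi,\widetilde\phi)\mid\phi\in A_m\setminus\{e^{ij}_{i'},e^{ij}_{j'}\mid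 1\le i<j\le 2m\}\}.$$ *)

theory Defs
  imports
    "HOL-Computational_Algebra.Polynomial"
    "HOL-Library.Set_Algebras"
    "HOL-Library.Function_Algebras"
    "HOL-Library.Product_Plus"
    "HOL-Algebra.Module"
begin

section \<open>Quotient spaces, bases, isomorphisms\<close>

text \<open>
  Vector spaces are carriers inside a type of functions (or of pairs of functions) on which
  addition is pointwise; the pointwise scalar multiplication \<open>sc\<close> is passed as a parameter.
  The quotient \<open>Z / B\<close> has the cosets \<open>z + B\<close> as elements. In \<open>smult\<close> the summand \<open>B\<close> only
  matters for the scalar \<open>0\<close>, where the image of a coset is the set \<open>{0}\<close>.
  The ring multiplication and unit of the \<open>module\<close> record play no role.
\<close>

definition quotient_space ::
  "('a \<Rightarrow> 'v \<Rightarrow> 'v) \<Rightarrow> 'v set \<Rightarrow> 'v set \<Rightarrow> ('a, 'v::ab_group_add set) module" where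
  "quotient_space sc Z B =
     \<lparr>carrier = (\<lambda>z. z +o B) ` Z, mult = undefined, one = undefined,
      zero = B, add = (\<lambda>X Y. X + Y), smult = (\<lambda>a X. sc a ` X + B)\<rparr>"

definition independent_in :: "('a::zero, 'v) module \<Rightarrow> 'v set \<Rightarrow> bool" where
  "independent_in M S \<longleftrightarrow> S \<subseteq> carrier M \<and>
     (\<forall>T c. finite T \<and> T \<subseteq> S \<and> (\<Oplus>\<^bsub>M\<^esub>t\<in>T. c t \<odot>\<^bsub>M\<^esub> t) = \<zero>\<^bsub>M\<^esub> \<longrightarrow> (\<forall>t\<in>T. c t = 0))"

definition basis_of :: "('a::zero, 'v) module \<Rightarrow> 'v set \<Rightarrow> bool" where
  "basis_of M S \<longleftrightarrow> independent_in M S \<and>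
     (\<forall>v\<in>carrier M. \<exists>T c. finite T \<and> T \<subseteq> S \<and> v = (\<Oplus>\<^bsub>M\<^esub>t\<in>T. c t \<odot>\<^bsub>M\<^esub> t))"

text \<open>Distinct elements of \<open>S\<close> are required to have distinct classes.\<close>

definition classes_form_basis ::
  "('a::zero \<Rightarrow> 'v \<Rightarrow> 'v) \<Rightarrow> 'v set \<Rightarrow> 'v set \<Rightarrow> 'v::ab_group_add set \<Rightarrow> bool" where
  "classes_form_basis sc Z B S \<longleftrightarrow> S \<subseteq> Z \<and> inj_on (\<lambda>s. s +o B) S \<and>
     basis_of (quotient_space sc Z B) ((\<lambda>s. s +o B) ` S)"

definition linearly_isomorphic :: "('a, 'v) module \<Rightarrow> ('a, 'w) module \<Rightarrow> bool" where
  "linearly_isomorphic M N \<longleftrightarrow>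
     (\<exists>f. bij_betw f (carrier M) (carrier N) \<and>
          (\<forall>x\<in>carrier M. \<forall>y\<in>carrier M. f (x \<oplus>\<^bsub>M\<^esub> y) = f x \<oplus>\<^bsub>N\<^esub> f y) \<and>
          (\<forall>a. \<forall>x\<in>carrier M. f (a \<odot>\<^bsub>M\<^esub> x) = a \<odot>\<^bsub>N\<^esub> f x))"


section \<open>The restricted Heisenberg algebras\<close>

text \<open>
  An element \<open>\<Sum> a\<^sub>i e\<^sub>i\<close> is its coordinate function on \<open>{1..2m+1}\<close>, extended by \<open>0\<close>.
\<close>

type_synonym 'a vec = "nat \<Rightarrow> 'a"

definition heis :: "nat \<Rightarrow> 'a::field vec set" where
  "heis m = {g. \<forall>i. i \<notin> {1..2*m+1} \<longrightarrow> g i = 0}"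

definition evec :: "nat \<Rightarrow> 'a::field vec" where
  "evec i = (\<lambda>k. if k = i then 1 else 0)"

definition vscale :: "'a::field \<Rightarrow> 'a vec \<Rightarrow> 'a vec" where
  "vscale a g = (\<lambda>k. a * g k)"

text \<open>Bilinear extension of \<open>[e\<^sub>i, e\<^sub>m\<^sub>+\<^sub>i] = e\<^sub>2\<^sub>m\<^sub>+\<^sub>1 = - [e\<^sub>m\<^sub>+\<^sub>i, e\<^sub>i]\<close>.\<close>

definition br :: "nat \<Rightarrow> 'a::field vec \<Rightarrow> 'a vec \<Rightarrow> 'a vec" where
  "br m g h = vscale (\<Sum>i=1..m. g i * h (m+i) - g (m+i) * h i) (evec (2*m+1))"

definition pmap :: "nat \<Rightarrow> (nat \<Rightarrow> 'a::field) \<Rightarrow> 'a vec \<Rightarrow> 'a vec" where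
  "pmap m lam g =
     vscale ((\<Sum>i=1..2*m+1. (g i)^2 * lam i) + (\<Sum>j=1..m. g j * g (m+j))) (evec (2*m+1))"

text \<open>The involution \<open>i \<mapsto> i'\<close> of \<open>{1..2m+1}\<close>.\<close>

definition prm :: "nat \<Rightarrow> nat \<Rightarrow> nat" where
  "prm m i = (if i \<le> m then i + m else if i \<le> 2*m then i - m else i)"


section \<open>Ordinary cohomology with adjoint coefficients\<close>

text \<open>
  Cochains are extended by \<open>0\<close> to arguments outside \<open>heis m\<close>, so that each of them is
  represented by exactly one function; \<open>Hom (\<Lambda>\<^sup>2 \<hh>) \<hh>\<close> is the space of alternating bilinear maps.
\<close>

type_synonym 'a cochain1 = "'a vec \<Rightarrow> 'a vec"
type_synonym 'a cochain2 = "'a vec \<Rightarrow> 'a vec \<Rightarrow> 'a vec"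
type_synonym 'a cochain3 = "'a vec \<Rightarrow> 'a vec \<Rightarrow> 'a vec \<Rightarrow> 'a vec"

definition scale1 :: "'a::field \<Rightarrow> 'a cochain1 \<Rightarrow> 'a cochain1" where
  "scale1 a \<psi> = (\<lambda>g. vscale a (\<psi> g))"

definition scale2 :: "'a::field \<Rightarrow> 'a cochain2 \<Rightarrow> 'a cochain2" where
  "scale2 a \<phi> = (\<lambda>g h. vscale a (\<phi> g h))"

definition C1 :: "nat \<Rightarrow> 'a::field cochain1 set" where
  "C1 m = {\<psi>. (\<forall>g\<in>heis m. \<psi> g \<in> heis m) \<and>
             (\<forall>g\<in>heis m. \<forall>h\<in>heis m. \<psi> (g + h) = \<psi> g + \<psi> h) \<and>
             (\<forall>a. \<forall>g\<in>heis m. \<psi> (vscale a g) = vscale a (\<psi> g)) \<and>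
             (\<forall>g. g \<notin> heis m \<longrightarrow> \<psi> g = 0)}"

definition C2 :: "nat \<Rightarrow> 'a::field cochain2 set" where
  "C2 m = {\<phi>. (\<forall>g. \<phi> g \<in> C1 m) \<and> (\<forall>h. (\<lambda>g. \<phi> g h) \<in> C1 m) \<and> (\<forall>g. \<phi> g g = 0)}"

definition d1 :: "nat \<Rightarrow> 'a::field cochain1 \<Rightarrow> 'a cochain2" where
  "d1 m \<psi> = (\<lambda>g h. if g \<in> heis m \<and> h \<in> heis m
      then br m g (\<psi> h) - br m h (\<psi> g) - \<psi> (br m g h) else 0)"

definition d2 :: "nat \<Rightarrow> 'a::field cochain2 \<Rightarrow> 'a cochain3" where
  "d2 m \<phi> = (\<lambda>g h k. if g \<in> heis m \<and> h \<in> heis m \<and> k \<in> heis m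
      then br m g (\<phi> h k) - br m h (\<phi> g k) + br m k (\<phi> g h)
           - \<phi> (br m g h) k + \<phi> (br m g k) h - \<phi> (br m h k) g else 0)"

definition Z2 :: "nat \<Rightarrow> 'a::field cochain2 set" where
  "Z2 m = {\<phi> \<in> C2 m. d2 m \<phi> = 0}"

definition B2 :: "nat \<Rightarrow> 'a::field cochain2 set" where
  "B2 m = d1 m ` C1 m"

definition H2 :: "nat \<Rightarrow> ('a::field, 'a cochain2 set) module" where
  "H2 m = quotient_space scale2 (Z2 m) (B2 m)"


section \<open>Restricted cohomology in characteristic 2\<close>

definition compatible :: "nat \<Rightarrow> 'a::field cochain2 \<Rightarrow> ('a vec \<Rightarrow> 'a vec) \<Rightarrow> bool" where
  "compatible m \<phi> \<omega> \<longleftrightarrow>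
     (\<forall>g\<in>heis m. \<omega> g \<in> heis m) \<and>
     (\<forall>a. \<forall>g\<in>heis m. \<omega> (vscale a g) = vscale (a^2) (\<omega> g)) \<and>
     (\<forall>g\<in>heis m. \<forall>h\<in>heis m. \<omega> (g + h) = \<omega> g + \<omega> h + \<phi> g h) \<and>
     (\<forall>g. g \<notin> heis m \<longrightarrow> \<omega> g = 0)"

type_synonym 'a rcochain2 = "'a cochain2 \<times> ('a vec \<Rightarrow> 'a vec)"

definition rscale2 :: "'a::field \<Rightarrow> 'a rcochain2 \<Rightarrow> 'a rcochain2" where
  "rscale2 a = (\<lambda>(\<phi>, \<omega>). (scale2 a \<phi>, scale1 a \<omega>))"

definition rC2 :: "nat \<Rightarrow> 'a::field rcochain2 set" where
  "rC2 m = {(\<phi>, \<omega>). \<phi> \<in> C2 m \<and> compatible m \<phi> \<omega>}"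

definition ind1 :: "nat \<Rightarrow> (nat \<Rightarrow> 'a::field) \<Rightarrow> 'a cochain1 \<Rightarrow> 'a vec \<Rightarrow> 'a vec" where
  "ind1 m lam \<psi> = (\<lambda>g. if g \<in> heis m then \<psi> (pmap m lam g) - br m g (\<psi> g) else 0)"

definition ind2 ::
  "nat \<Rightarrow> (nat \<Rightarrow> 'a::field) \<Rightarrow> 'a rcochain2 \<Rightarrow> 'a vec \<Rightarrow> 'a vec \<Rightarrow> 'a vec" where
  "ind2 m lam = (\<lambda>(\<phi>, \<omega>) g h. if g \<in> heis m \<and> h \<in> heis m
      then \<phi> g (pmap m lam h) + br m g (\<omega> h) + \<phi> h (br m h g) + br m h (\<phi> h g) else 0)"

definition rd1 :: "nat \<Rightarrow> (nat \<Rightarrow> 'a::field) \<Rightarrow> 'a cochain1 \<Rightarrow> 'a rcochain2" where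
  "rd1 m lam \<psi> = (d1 m \<psi>, ind1 m lam \<psi>)"

definition rd2 ::
  "nat \<Rightarrow> (nat \<Rightarrow> 'a::field) \<Rightarrow> 'a rcochain2 \<Rightarrow> 'a cochain3 \<times> ('a vec \<Rightarrow> 'a vec \<Rightarrow> 'a vec)" where
  "rd2 m lam x = (d2 m (fst x), ind2 m lam x)"

definition rZ2 :: "nat \<Rightarrow> (nat \<Rightarrow> 'a::field) \<Rightarrow> 'a rcochain2 set" where
  "rZ2 m lam = {x \<in> rC2 m. rd2 m lam x = 0}"

definition rB2 :: "nat \<Rightarrow> (nat \<Rightarrow> 'a::field) \<Rightarrow> 'a rcochain2 set" where
  "rB2 m lam = rd1 m lam ` C1 m"

definition rH2 :: "nat \<Rightarrow> (nat \<Rightarrow> 'a::field) \<Rightarrow> ('a, 'a rcochain2 set) module" where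
  "rH2 m lam = quotient_space rscale2 (rZ2 m lam) (rB2 m lam)"


section \<open>The explicit cocycles\<close>

text \<open>\<open>ecoch m i j k\<close> is the cochain written \<open>e\<^sup>i\<^sup>j\<^sub>k\<close>, for \<open>i \<noteq> j\<close>; \<open>ebar m i j\<close> has upper index \<open>i\<close>.\<close>

definition ecoch :: "nat \<Rightarrow> nat \<Rightarrow> nat \<Rightarrow> nat \<Rightarrow> 'a::field cochain2" where
  "ecoch m i j k = (\<lambda>g h. if g \<in> heis m \<and> h \<in> heis m
      then vscale (g i * h j - g j * h i) (evec k) else 0)"

definition ebar :: "nat \<Rightarrow> nat \<Rightarrow> nat \<Rightarrow> 'a::field vec \<Rightarrow> 'a vec" where
  "ebar m i j = (\<lambda>g. if g \<in> heis m then vscale ((g i)^2) (evec j) else 0)"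

definition tilde :: "nat \<Rightarrow> 'a::field cochain2 \<Rightarrow> 'a vec \<Rightarrow> 'a vec" where
  "tilde m \<phi> = (THE \<omega>. compatible m \<phi> \<omega> \<and> (\<forall>i\<in>{1..2*m+1}. \<omega> (evec i) = 0))"

definition same_half :: "nat \<Rightarrow> nat set \<Rightarrow> bool" where
  "same_half m I \<longleftrightarrow> I \<subseteq> {1..m} \<or> I \<subseteq> {m+1..2*m}"

definition A1 :: "nat \<Rightarrow> 'a::field cochain2 set" where
  "A1 m = {ecoch m i j (prm m i) | i j. 1 \<le> i \<and> i < j \<and> j \<le> 2*m} \<union>
          {ecoch m i j (prm m j) | i j. 1 \<le> i \<and> i < j \<and> j \<le> 2*m}"

definition A2 :: "nat \<Rightarrow> 'a::field cochain2 set" where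
  "A2 m = {ecoch m i (prm m j) (prm m j) + ecoch m j (prm m j) (prm m i) | i j. i \<noteq> j \<and> same_half m {i, j}} \<union>
          {ecoch m i j j + ecoch m j (prm m j) (prm m i) | i j. i \<noteq> j \<and> same_half m {i, j}}"

definition A3 :: "nat \<Rightarrow> 'a::field cochain2 set" where
  "A3 m = {ecoch m k j (prm m i) + ecoch m i j (prm m k) | i j k.
             (1 \<le> k \<and> k < i \<and> i < j \<and> j \<le> m) \<or> (m+1 \<le> i \<and> i < j \<and> j < k \<and> k \<le> 2*m)} \<union>
          {ecoch m k i (prm m j) - ecoch m i j (prm m k) | i j k.
             (1 \<le> k \<and> k < i \<and> i < j \<and> j \<le> m) \<or> (m+1 \<le> i \<and> i < j \<and> j < k \<and> k \<le> 2*m)}"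

definition A4 :: "nat \<Rightarrow> 'a::field cochain2 set" where
  "A4 m = {ecoch m i (prm m k) (prm m j) - ecoch m i j k | i j k.
             k \<noteq> i \<and> k \<noteq> j \<and> i < j \<and> same_half m {i, j, k}} \<union>
          {ecoch m j (prm m k) (prm m i) + ecoch m i j k | i j k.
             k \<noteq> i \<and> k \<noteq> j \<and> i < j \<and> same_half m {i, j, k}}"

definition A_set :: "nat \<Rightarrow> 'a::field cochain2 set" where
  "A_set m = A1 m \<union> A2 m \<union> A3 m \<union> A4 m"

definition A_restr :: "nat \<Rightarrow> 'a::field rcochain2 set" where
  "A_restr m =
     {(ecoch m i j (prm m i), tilde m (ecoch m i j (prm m i)) + ebar m i (prm m j)) | i j.
        1 \<le> i \<and> i < j \<and> j \<le> 2*m} \<union>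
     {(ecoch m i j (prm m j), tilde m (ecoch m i j (prm m j)) + ebar m j (prm m i)) | i j.
        1 \<le> i \<and> i < j \<and> j \<le> 2*m} \<union>
     {(\<phi>, tilde m \<phi>) | \<phi>. \<phi> \<in> A_set m - A1 m}"

end

theory Submission
  imports Defs
begin

text \<open>
  Write \<open>V\<close> for the span of \<open>e\<^sub>1, \<dots>, e\<^sub>2\<^sub>m\<close>, write \<open>z = e\<^sub>2\<^sub>m\<^sub>+\<^sub>1\<close>, and let
  \<open>\<sigma>\<close> be the symplectic form with \<open>[g, h] = \<sigma>(g, h) z\<close>.

  Ordinary cocycles. Evaluating \<open>d\<^sup>2 \<phi> = 0\<close> on \<open>e\<^sub>i\<close>, \<open>e\<^sub>i\<^sub>'\<close> and a third basis vector shows,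
  because \<open>m > 1\<close>, that \<open>\<phi>(\<cdot>, z)\<close> takes values in the line of \<open>z\<close> (\<open>Z2_center_line\<close>).
  Subtracting the coboundary of a map that sends \<open>z\<close> to a suitable vector makes \<open>\<phi>(\<cdot>, z)\<close> vanish,
  and then \<open>\<phi>\<close> is a cocycle exactly when the coefficients \<open>\<phi>\<^sub>a\<^sub>b\<^sub>;\<^sub>c\<close> of \<open>e\<^sub>c\<^sub>'\<close> in
  \<open>\<phi>(e\<^sub>a, e\<^sub>b)\<close> have cyclic sum zero (\<open>Z2_cyclic\<close>). So for each pair \<open>{a, b}\<close> the two coefficients
  with \<open>c = a\<close> and \<open>c = b\<close> are free, and for each three-element set \<open>{a, b, c}\<close> two of
  the three coefficients are free and determine the third. The first kind of freedom is the family
  \<open>A1\<close>. The families \<open>A2\<close>, \<open>A3\<close>, \<open>A4\<close> are the second kind: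
  they all consist of sums of two basic cochains attached to a three-element set in which one
  element, called the pivot here, is singled out. The part of \<open>\<phi>\<close> with values in the line of \<open>z\<close>
  is a coboundary, since every alternating form is \<open>b(g, h) + b(h, g)\<close> for some bilinear \<open>b\<close>.

  Restricted cocycles. For a cocycle \<open>\<phi>\<close> the equation \<open>ind\<^sup>2(\<phi>, \<omega>) = 0\<close> determines the
  \<open>V\<close>-component of \<open>\<omega>\<close> and leaves the \<open>z\<close>-components of the \<open>2m+1\<close> values \<open>\<omega>(e\<^sub>i)\<close> free. When
  \<open>\<phi> = d\<^sup>1 \<psi>\<close>, the map \<open>\<psi>\<close> can still be changed without changing \<open>\<phi>\<close>: the diagonal of \<open>b\<close> absorbs
  the values at \<open>e\<^sub>1, \<dots>, e\<^sub>2\<^sub>m\<close>, while at \<open>z\<close> one can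
  only change \<open>\<omega>(z)\<close> by \<open>c \<lambda>\<^sub>2\<^sub>m\<^sub>+\<^sub>1 z\<close>, where \<open>c\<close> is the \<open>z\<close>-component of \<open>\<psi>(z)\<close>. This is the difference between the
  two cases: if \<open>\<lambda>\<^sub>2\<^sub>m\<^sub>+\<^sub>1 = 0\<close>, the class of \<open>(0, e\<^sup>2\<^sup>m\<^sup>+\<^sup>1\<^sub>2\<^sub>m\<^sub>+\<^sub>1)\<close> survives, and otherwise forgetting
  \<open>\<omega>\<close> is an isomorphism onto \<open>H\<^sup>2\<close>.

  All basis statements are proved by one principle (\<open>classes_form_basis_from_coordinates\<close>): linear
  functionals on cocycles which kill the coboundaries, are dual to the listed cocycles, and whose common
  kernel consists of coboundaries. The functionals are \<open>coord\<close>, together with the \<open>z\<close>-component of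
  \<open>\<omega>(z)\<close> in the first case. The three requirements are \<open>coord_d1\<close>, \<open>coord_cocycle\<close> and
  \<open>restricted_coboundary_if_coord_0\<close>.
\<close>

section \<open>Quotient spaces\<close>

context vector_space
begin

lemma coset_eq_iff:
  assumes "subspace B"
  shows "z +o B = w +o B \<longleftrightarrow> z - w \<in> B"
proof
  assume "z +o B = w +o B"
  moreover have "z \<in> z +o B"
    using subspace_0[OF assms] by (force simp: elt_set_plus_def)
  ultimately show "z - w \<in> B" by (auto simp: elt_set_plus_def)
next
  assume *: "z - w \<in> B"
  have "w - z \<in> B" using subspace_neg[OF assms *] by simp
  have "v +o B \<subseteq> u +o B" if "v - u \<in> B" for u v
  proof
    fix x assume "x \<in> v +o B"
    then obtain b where b: "b \<in> B" "x = v + b" by (auto simp: elt_set_plus_def)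
    have "x = u + (v - u + b)" using b by simp
    then show "x \<in> u +o B"
      using subspace_add[OF assms that b(1)] unfolding elt_set_plus_def by blast
  qed
  then show "z +o B = w +o B" using * \<open>w - z \<in> B\<close> by blast
qed

lemma coset_eq_self_iff: "subspace B \<Longrightarrow> z +o B = B \<longleftrightarrow> z \<in> B"
  using coset_eq_iff[of B z 0] by simp

lemma coset_add:
  assumes "subspace B"
  shows "(z +o B) + (w +o B) = (z + w) +o B"
proof -
  have "B + B = B"
    using subspace_0[OF assms] subspace_add[OF assms]
    by (auto simp: set_plus_def) (metis add.right_neutral)
  then show ?thesis by (simp add: set_plus_rearrange)
qed

lemma coset_scale:
  assumes "subspace B"
  shows "scale a ` (z +o B) + B = scale a z +o B"
proof (intro Set.set_eqI iffI)
  fix x assume "x \<in> scale a ` (z +o B) + B"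
  then obtain b b' where b: "b \<in> B" "b' \<in> B" "x = scale a (z + b) + b'"
    by (auto simp: elt_set_plus_def elim!: set_plus_elim)
  then have "x = scale a z + (scale a b + b')" by (simp add: scale_right_distrib add.assoc)
  moreover have "scale a b + b' \<in> B"
    using b assms by (intro subspace_add subspace_scale)
  ultimately show "x \<in> scale a z +o B" unfolding elt_set_plus_def by blast
next
  fix x assume "x \<in> scale a z +o B"
  then obtain b where "b \<in> B" "x = scale a z + b" by (auto simp: elt_set_plus_def)
  moreover have "z \<in> z +o B" using subspace_0[OF assms] by (force simp: elt_set_plus_def)
  ultimately show "x \<in> scale a ` (z +o B) + B" by (auto simp: set_plus_def)
qed

lemma quotient_abelian_monoid:
  assumes "subspace Z" "subspace B"
  shows "abelian_monoid (quotient_space scale Z B)"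
proof -
  have zero: "B + (z +o B) = z +o B" for z
    using coset_add[OF assms(2), of 0 z] by simp
  have "B \<in> (\<lambda>z. z +o B) ` Z"
    using subspace_0[OF assms(1)] by (intro image_eqI[of _ _ 0]) simp_all
  then show ?thesis
    by (intro abelian_monoidI)
      (auto simp: quotient_space_def coset_add[OF assms(2)] zero add_ac
        intro!: imageI subspace_add[OF assms(1)])
qed

lemma quotient_finsum:
  assumes "subspace Z" "subspace B" "finite T" "\<And>t. t \<in> T \<Longrightarrow> g t \<in> Z"
  shows "finsum (quotient_space scale Z B) (\<lambda>t. g t +o B) T = (\<Sum>t\<in>T. g t) +o B"
proof -
  interpret Q: abelian_monoid "quotient_space scale Z B"
    by (rule quotient_abelian_monoid) fact+
  show ?thesis
    using assms(3,4)
  proof (induction T)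
    case empty
    show ?case by (subst Q.finsum_empty) (simp add: quotient_space_def)
  next
    case (insert t T)
    have "finsum (quotient_space scale Z B) (\<lambda>t. g t +o B) (insert t T)
        = (g t +o B) \<oplus>\<^bsub>quotient_space scale Z B\<^esub>
            finsum (quotient_space scale Z B) (\<lambda>t. g t +o B) T"
      using insert by (intro Q.finsum_insert) (auto simp: quotient_space_def)
    also have "\<dots> = (g t +o B) + ((\<Sum>t\<in>T. g t) +o B)"
      using insert by (simp add: quotient_space_def)
    finally show ?case using insert by (simp add: coset_add[OF assms(2)])
  qed
qed

text \<open>
  The functionals \<open>f i\<close> descend to the quotient, where duality gives independence. A cocycle minus
  its combination \<open>\<Sum>i. f i z \<cdot> rep i\<close> lies in the common kernel, which gives spanning.
\<close>

lemma classes_form_basis_from_coordinates: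
  assumes Z: "subspace Z" and B: "subspace B" and "finite I"
    and rep: "\<And>i. i \<in> I \<Longrightarrow> rep i \<in> Z"
    and f_add: "\<And>i x y. f i (x + y) = f i x + f i y"
    and f_scale: "\<And>i a x. f i (scale a x) = a * f i x"
    and dual: "\<And>i j. i \<in> I \<Longrightarrow> j \<in> I \<Longrightarrow> f i (rep j) = (if i = j then 1 else 0)"
    and f_B: "\<And>i b. i \<in> I \<Longrightarrow> b \<in> B \<Longrightarrow> f i b = 0"
    and kernel: "\<And>z. z \<in> Z \<Longrightarrow> (\<And>i. i \<in> I \<Longrightarrow> f i z = 0) \<Longrightarrow> z \<in> B"
  shows "classes_form_basis scale Z B (rep ` I)"
proof -
  let ?Q = "quotient_space scale Z B"
  define cls where "cls i = rep i +o B" for i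
  \<comment> \<open>Coefficients of a combination of classes are indexed by the classes themselves, so \<open>idx\<close>
    recovers the index.\<close>
  define idx where "idx = inv_into I cls"
  have f_0: "f i 0 = 0" for i using f_scale[of i 0 0] by simp
  have f_diff: "f i (x - y) = f i x - f i y" for i x y
    using f_add[of i "x - y" y] by simp
  have f_sum: "f i (\<Sum>t\<in>T. scale (c t) (g t)) = (\<Sum>t\<in>T. c t * f i (g t))"
    for i T and c :: "'x \<Rightarrow> 'a" and g :: "'x \<Rightarrow> 'b"
    by (induction T rule: infinite_finite_induct) (auto simp: f_0 f_add f_scale)
  have inj: "inj_on cls I"
  proof (rule inj_onI)
    fix i j assume ij: "i \<in> I" "j \<in> I" "cls i = cls j"
    then have "rep i - rep j \<in> B" by (simp add: cls_def coset_eq_iff[OF B])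
    then have "f i (rep i) = f i (rep j)" using f_B[of i] ij f_diff by fastforce
    then show "i = j" using dual ij by (auto split: if_splits)
  qed
  have idx_cls: "idx (cls i) = i" if "i \<in> I" for i
    using that inj by (simp add: idx_def)
  have cls_idx: "idx t \<in> I" "cls (idx t) = t" if "t \<in> cls ` I" for t
    using that by (auto simp: idx_cls)
  have image: "(\<lambda>s. s +o B) ` rep ` I = cls ` I" by (auto simp: cls_def)
  have combination: "(\<Oplus>\<^bsub>?Q\<^esub>t\<in>T. c t \<odot>\<^bsub>?Q\<^esub> t) = (\<Sum>t\<in>T. scale (c t) (rep (idx t))) +o B"
    if "finite T" "T \<subseteq> cls ` I" for T c
  proof -
    interpret Q: abelian_monoid ?Q by (rule quotient_abelian_monoid) fact+
    have 1: "c t \<odot>\<^bsub>?Q\<^esub> t = scale (c t) (rep (idx t)) +o B" if "t \<in> T" for t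
    proof -
      have "t = rep (idx t) +o B" using cls_idx that \<open>T \<subseteq> cls ` I\<close> by (auto simp: cls_def)
      then show ?thesis
        using coset_scale[OF B, of "c t" "rep (idx t)"] by (simp add: quotient_space_def)
    qed
    have 2: "scale (c t) (rep (idx t)) \<in> Z" if "t \<in> T" for t
      using cls_idx that \<open>T \<subseteq> cls ` I\<close> rep by (intro subspace_scale[OF Z]) auto
    have "(\<Oplus>\<^bsub>?Q\<^esub>t\<in>T. c t \<odot>\<^bsub>?Q\<^esub> t) = (\<Oplus>\<^bsub>?Q\<^esub>t\<in>T. scale (c t) (rep (idx t)) +o B)"
      by (rule Q.finsum_cong') (use 1 2 in \<open>auto simp: quotient_space_def\<close>)
    also have "\<dots> = (\<Sum>t\<in>T. scale (c t) (rep (idx t))) +o B"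
      by (rule quotient_finsum) (use Z B 2 that in auto)
    finally show ?thesis .
  qed
  have indep: "independent_in ?Q (cls ` I)"
    unfolding independent_in_def
  proof (intro conjI allI impI ballI)
    show "cls ` I \<subseteq> carrier ?Q" using rep by (auto simp: cls_def quotient_space_def)
    fix T c t
    assume T: "finite T \<and> T \<subseteq> cls ` I \<and> (\<Oplus>\<^bsub>?Q\<^esub>t\<in>T. c t \<odot>\<^bsub>?Q\<^esub> t) = \<zero>\<^bsub>?Q\<^esub>" and t: "t \<in> T"
    have tI: "idx t \<in> I" using cls_idx T t by auto
    have "(\<Sum>t\<in>T. scale (c t) (rep (idx t))) \<in> B"
      using combination[of T c] T coset_eq_self_iff[OF B] by (simp add: quotient_space_def)
    then have "0 = f (idx t) (\<Sum>t\<in>T. scale (c t) (rep (idx t)))"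
      using f_B[OF tI] by simp
    also have "\<dots> = (\<Sum>u\<in>T. c u * f (idx t) (rep (idx u)))"
      by (rule f_sum)
    also have "\<dots> = (\<Sum>u\<in>T. if u = t then c t else 0)"
    proof (rule sum.cong)
      fix u assume "u \<in> T"
      then have "u \<in> cls ` I" "t \<in> cls ` I" using T t by auto
      then have "idx u \<in> I" "idx t = idx u \<longleftrightarrow> u = t"
        using cls_idx by (blast, metis)
      then show "c u * f (idx t) (rep (idx u)) = (if u = t then c t else 0)"
        using dual tI by auto
    qed simp
    also have "\<dots> = c t" using T t by simp
    finally show "c t = 0" by simp
  qed
  have span: "\<exists>T c. finite T \<and> T \<subseteq> cls ` I \<and> v = (\<Oplus>\<^bsub>?Q\<^esub>t\<in>T. c t \<odot>\<^bsub>?Q\<^esub> t)"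
    if v: "v \<in> carrier ?Q" for v
  proof -
    obtain z where z: "z \<in> Z" "v = z +o B" using v by (auto simp: quotient_space_def)
    let ?s = "\<Sum>i\<in>I. scale (f i z) (rep i)"
    have "z - ?s \<in> B"
    proof (rule kernel)
      show "z - ?s \<in> Z"
        using z rep by (intro subspace_diff[OF Z] subspace_sum[OF Z] subspace_scale[OF Z]) auto
      fix i assume i: "i \<in> I"
      have "(\<Sum>j\<in>I. f j z * f i (rep j)) = (\<Sum>j\<in>I. if j = i then f i z else 0)"
        by (rule sum.cong) (use dual i in auto)
      then show "f i (z - ?s) = 0" using i \<open>finite I\<close> by (simp add: f_diff f_sum)
    qed
    then have "v = ?s +o B" using z coset_eq_iff[OF B] by simp
    also have "?s = (\<Sum>t\<in>cls ` I. scale (f (idx t) z) (rep (idx t)))"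
      using inj by (simp add: sum.reindex idx_cls)
    finally have "v = (\<Oplus>\<^bsub>?Q\<^esub>t\<in>cls ` I. f (idx t) z \<odot>\<^bsub>?Q\<^esub> t)"
      using combination[of "cls ` I"] \<open>finite I\<close> by simp
    then show ?thesis
      using \<open>finite I\<close> by (intro exI[of _ "cls ` I"] exI[of _ "\<lambda>t. f (idx t) z"]) simp
  qed
  have "inj_on (\<lambda>s. s +o B) (rep ` I)"
    using inj by (auto simp: inj_on_def cls_def)
  then show ?thesis
    using rep indep span
    by (auto simp: classes_form_basis_def basis_of_def image)
qed

end

text \<open>
  The induced map of quotients is taking images under \<open>\<pi>\<close>: the image of a coset of \<open>B\<close> is a whole
  coset of \<open>B'\<close> because \<open>\<pi>\<close> maps \<open>B\<close> onto \<open>B'\<close>.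
\<close>

lemma linearly_isomorphic_quotients:
  assumes "vector_space sc" "vector_space sc'"
    and \<pi>_add: "\<And>x y. \<pi> (x + y) = \<pi> x + \<pi> y"
    and \<pi>_scale: "\<And>a x. \<pi> (sc a x) = sc' a (\<pi> x)"
    and Z: "\<pi> ` Z = Z'" and B: "\<pi> ` B = B'"
    and "Modules.module.subspace sc Z" "Modules.module.subspace sc B" "Modules.module.subspace sc' B'"
    and kernel: "\<And>x. x \<in> Z \<Longrightarrow> \<pi> x \<in> B' \<Longrightarrow> x \<in> B"
  shows "linearly_isomorphic (quotient_space sc Z B) (quotient_space sc' Z' B')"
proof -
  interpret v: vector_space sc by fact
  interpret v': vector_space sc' by fact
  have \<pi>_diff: "\<pi> (x - y) = \<pi> x - \<pi> y" for x y
    using \<pi>_add[of "x - y" y] by simp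
  have coset: "\<pi> ` (z +o B) = \<pi> z +o B'" for z
    by (force simp: elt_set_plus_def \<pi>_add B[symmetric])
  have plus: "\<pi> ` (X + Y) = \<pi> ` X + \<pi> ` Y" for X Y
    by (force simp: set_plus_def \<pi>_add)
  have "bij_betw (image \<pi>) ((\<lambda>z. z +o B) ` Z) ((\<lambda>z. z +o B') ` Z')"
    unfolding bij_betw_def
  proof
    show "inj_on (image \<pi>) ((\<lambda>z. z +o B) ` Z)"
    proof (rule inj_onI; clarsimp simp: coset v.coset_eq_iff[OF assms(8)] v'.coset_eq_iff[OF assms(9)])
      fix x y assume "x \<in> Z" "y \<in> Z" "\<pi> x - \<pi> y \<in> B'"
      then show "x - y \<in> B" 
        using kernel[of "x - y"] v.subspace_diff[OF assms(7)] by (simp add: \<pi>_diff)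
    qed
    show "image \<pi> ` (\<lambda>z. z +o B) ` Z = (\<lambda>z. z +o B') ` Z'"
      by (auto simp: coset Z[symmetric] image_image)
  qed
  moreover have "\<pi> ` (sc a ` X + B) = sc' a ` (\<pi> ` X) + B'" for a X
    by (simp add: plus B image_image \<pi>_scale)
  ultimately show ?thesis
    unfolding linearly_isomorphic_def
    by (intro exI[of _ "image \<pi>"]) (simp add: quotient_space_def plus)
qed

section \<open>Cochains as vector spaces\<close>

text \<open>
  The standard symplectic form on the span of \<open>e\<^sub>1, \<dots>, e\<^sub>2\<^sub>m\<close>, extended by zero to the centre.
\<close>

definition sform :: "nat \<Rightarrow> 'a::field vec \<Rightarrow> 'a vec \<Rightarrow> 'a" where
  "sform m g h = (\<Sum>i=1..m. g i * h (m+i) - g (m+i) * h i)"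

lemma br_eq: "br m g h = vscale (sform m g h) (evec (2*m+1))"
  by (simp add: br_def sform_def)

interpretation vec: vector_space "vscale :: 'a::field \<Rightarrow> _"
  by unfold_locales (auto simp: vscale_def fun_eq_iff algebra_simps)

interpretation cochain1: vector_space "scale1 :: 'a::field \<Rightarrow> _"
  by unfold_locales (auto simp: scale1_def vscale_def fun_eq_iff algebra_simps)

interpretation cochain2: vector_space "scale2 :: 'a::field \<Rightarrow> _"
  by unfold_locales (auto simp: scale2_def vscale_def fun_eq_iff algebra_simps)

interpretation rcochain2: vector_space "rscale2 :: 'a::field \<Rightarrow> _"
  by unfold_locales
    (auto simp: rscale2_def scale1_def scale2_def vscale_def fun_eq_iff algebra_simps)

lemma sform_bilinear [simp]:
  "sform m (g + h) k = sform m g k + sform m h k"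
  "sform m k (g + h) = sform m k g + sform m k h"
  "sform m (g - h) k = sform m g k - sform m h k"
  "sform m k (g - h) = sform m k g - sform m k h"
  "sform m (vscale a g) k = a * sform m g k"
  "sform m k (vscale a g) = a * sform m k g"
  "sform m 0 k = 0" "sform m k 0 = 0"
  by (simp_all add: sform_def vscale_def algebra_simps sum.distrib sum_subtractf sum_distrib_left)

lemma sform_self [simp]: "sform m g g = 0"
  by (simp add: sform_def mult.commute)

lemma sform_commute: "sform m g h = - sform m h g"
  by (simp add: sform_def sum_negf[symmetric] algebra_simps)

lemma sform_center [simp]:
  "sform m (evec (Suc (2*m))) k = 0" "sform m k (evec (Suc (2*m))) = 0"
  by (auto simp: sform_def evec_def intro!: sum.neutral)

lemma br_bilinear [simp]:
  "br m (g + h) k = br m g k + br m h k"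
  "br m k (g + h) = br m k g + br m k h"
  "br m (g - h) k = br m g k - br m h k"
  "br m k (g - h) = br m k g - br m k h"
  "br m (vscale a g) k = vscale a (br m g k)"
  "br m k (vscale a g) = vscale a (br m k g)"
  "br m 0 k = 0" "br m k 0 = 0"
  by (simp_all add: br_eq vec.scale_left_distrib vec.scale_left_diff_distrib)

lemma br_self [simp]: "br m g g = 0"
  by (simp add: br_eq)

lemma br_center [simp]:
  "br m g (evec (Suc (2*m))) = 0" "br m (evec (Suc (2*m))) g = 0"
  "br m g (br m h k) = 0" "br m (br m h k) g = 0"
  "br m g (pmap m lam h) = 0" "br m (pmap m lam h) g = 0"
  by (simp_all add: br_eq pmap_def)

lemma heis_subspace: "vec.subspace (heis m)"
  by (rule vec.subspaceI) (auto simp: heis_def vscale_def)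

lemmas heis_closed [simp] =
  vec.subspace_0[OF heis_subspace] vec.subspace_add[OF heis_subspace]
  vec.subspace_diff[OF heis_subspace] vec.subspace_scale[OF heis_subspace]

lemma evec_heis [simp]: "1 \<le> i \<Longrightarrow> i \<le> Suc (2*m) \<Longrightarrow> evec i \<in> heis m"
  by (auto simp: heis_def evec_def)

lemma br_heis [simp]: "br m g h \<in> heis m"
  by (simp add: br_eq)

lemma pmap_heis [simp]: "pmap m lam g \<in> heis m"
  by (simp add: pmap_def)

lemma sum_fun_apply: "(\<Sum>i\<in>I. f i) k = (\<Sum>i\<in>I. f i k)"
  by (induction I rule: infinite_finite_induct) simp_all

lemma heis_expand:
  assumes "g \<in> heis m"
  shows "g = (\<Sum>i=1..2*m+1. vscale (g i) (evec i))"
proof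
  fix k
  have "(\<Sum>i=1..2*m+1. vscale (g i) (evec i)) k = (\<Sum>i=1..2*m+1. g i * (if k = i then 1 else 0))"
    unfolding sum_fun_apply by (simp add: vscale_def evec_def)
  also have "\<dots> = (if k \<in> {1..2*m+1} then g k else 0)"
    by (simp only: if_distrib[of "\<lambda>x. _ * x"] mult_1_right mult_zero_right sum.delta' finite_atLeastAtMost)
  finally show "g k = (\<Sum>i=1..2*m+1. vscale (g i) (evec i)) k"
    using assms by (auto simp: heis_def)
qed

text \<open>
  Stated for additive maps so as to apply both to linear maps and to maps with
  \<open>\<omega>(a g) = a\<^sup>2 \<omega>(g)\<close>.
\<close>

lemma additive_on_heis_eq_0:
  fixes f :: "'a::field vec \<Rightarrow> 'b::ab_group_add"
  assumes add: "\<And>g h. g \<in> heis m \<Longrightarrow> h \<in> heis m \<Longrightarrow> f (g + h) = f g + f h"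
    and basis: "\<And>a i. 1 \<le> i \<Longrightarrow> i \<le> 2*m+1 \<Longrightarrow> f (vscale a (evec i)) = 0"
    and g: "g \<in> heis m"
  shows "f g = 0"
proof -
  have f0: "f 0 = 0" using add[of 0 0] by simp
  have "f (\<Sum>i\<in>I. vscale (g i) (evec i)) = 0" if "finite I" "I \<subseteq> {1..2*m+1}" for I
    using that
  proof (induction I)
    case (insert i I)
    have "(\<Sum>i\<in>I. vscale (g i) (evec i)) \<in> heis m"
      using insert by (intro vec.subspace_sum[OF heis_subspace]) auto
    then have "f (vscale (g i) (evec i) + (\<Sum>i\<in>I. vscale (g i) (evec i))) = 0"
      using insert by (subst add) (simp_all add: basis)
    then show ?case using insert by (simp only: sum.insert not_False_eq_True)
  qed (simp add: f0)
  from this[of "{1..2*m+1}"] show ?thesis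
    using heis_expand[OF g] by simp
qed

lemma C1_D:
  assumes "\<psi> \<in> C1 m"
  shows "\<psi> g \<in> heis m" "g \<notin> heis m \<Longrightarrow> \<psi> g = 0"
    "g \<in> heis m \<Longrightarrow> h \<in> heis m \<Longrightarrow> \<psi> (g + h) = \<psi> g + \<psi> h"
    "g \<in> heis m \<Longrightarrow> \<psi> (vscale a g) = vscale a (\<psi> g)"
    "\<psi> 0 = 0"
proof -
  show *: "g \<in> heis m \<Longrightarrow> \<psi> (vscale a g) = vscale a (\<psi> g)" for a g
    using assms by (simp add: C1_def)
  show "\<psi> 0 = 0" using *[of 0 0] by simp
  show "\<psi> g \<in> heis m"
    using assms by (cases "g \<in> heis m") (auto simp: C1_def)
qed (use assms in \<open>auto simp: C1_def\<close>)

lemma C1_subspace: "cochain1.subspace (C1 m)"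
  by (rule cochain1.subspaceI)
    (auto simp: C1_def scale1_def vec.scale_right_distrib vec.scale_left_commute)

lemma C2_subspace: "cochain2.subspace (C2 m)"
proof -
  have "(\<lambda>g. 0) \<in> C1 m"
    using cochain1.subspace_0[OF C1_subspace] by (simp add: zero_fun_def)
  moreover have "(\<lambda>g. \<psi> g + \<psi>' g) \<in> C1 m" if "\<psi> \<in> C1 m" "\<psi>' \<in> C1 m" for \<psi> \<psi>' :: "'a cochain1"
    using cochain1.subspace_add[OF C1_subspace that] by (simp add: plus_fun_def)
  moreover have "(\<lambda>g. vscale a (\<psi> g)) \<in> C1 m" if "\<psi> \<in> C1 m" for \<psi> :: "'a cochain1" and a
    using cochain1.subspace_scale[OF C1_subspace that] by (simp add: scale1_def)
  ultimately show ?thesis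
    by (intro cochain2.subspaceI)
      (auto simp: C2_def scale2_def plus_fun_def[where 'a = "nat \<Rightarrow> 'a"] zero_fun_def[where 'a = "nat \<Rightarrow> 'a"])
qed

lemma C2_D:
  assumes "\<phi> \<in> C2 m"
  shows "\<phi> g h \<in> heis m" "g \<notin> heis m \<Longrightarrow> \<phi> g h = 0" "h \<notin> heis m \<Longrightarrow> \<phi> g h = 0"
    "g \<in> heis m \<Longrightarrow> h \<in> heis m \<Longrightarrow> \<phi> (g + h) k = \<phi> g k + \<phi> h k"
    "g \<in> heis m \<Longrightarrow> h \<in> heis m \<Longrightarrow> \<phi> k (g + h) = \<phi> k g + \<phi> k h"
    "g \<in> heis m \<Longrightarrow> \<phi> (vscale a g) k = vscale a (\<phi> g k)"
    "g \<in> heis m \<Longrightarrow> \<phi> k (vscale a g) = vscale a (\<phi> k g)"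
    "\<phi> 0 k = 0" "\<phi> k 0 = 0" "\<phi> g g = 0"
proof -
  have 1: "\<phi> g \<in> C1 m" and 2: "(\<lambda>g. \<phi> g h) \<in> C1 m" and "\<phi> g g = 0" for g h
    using assms by (auto simp: C2_def)
  then show "\<phi> g g = 0" by simp
  note right = C1_D[OF 1] and left = C1_D[OF 2]
  show "\<phi> g h \<in> heis m" by (rule right(1))
  show "\<phi> g h = 0" if "h \<notin> heis m" by (rule right(2)[OF that])
  show "\<phi> k (g + h) = \<phi> k g + \<phi> k h" if "g \<in> heis m" "h \<in> heis m"
    by (rule right(3)[OF that])
  show "\<phi> k (vscale a g) = vscale a (\<phi> k g)" if "g \<in> heis m" by (rule right(4)[OF that])
  show "\<phi> k 0 = 0" by (rule right(5))
  show "\<phi> g h = 0" if "g \<notin> heis m" by (rule left(2)[OF that])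
  show "\<phi> (g + h) k = \<phi> g k + \<phi> h k" if "g \<in> heis m" "h \<in> heis m"
    by (rule left(3)[OF that])
  show "\<phi> (vscale a g) k = vscale a (\<phi> g k)" if "g \<in> heis m" by (rule left(4)[OF that])
  show "\<phi> 0 k = 0" by (rule left(5))
qed

lemma C2_antisym:
  assumes "\<phi> \<in> C2 m"
  shows "\<phi> g h = - \<phi> h g"
proof (cases "g \<in> heis m \<and> h \<in> heis m")
  case True
  then have "0 = \<phi> (g + h) (g + h)" using C2_D(10)[OF assms] by simp
  also have "\<dots> = \<phi> g h + \<phi> h g"
    using True by (simp only: C2_D(4,5)[OF assms]) (simp add: C2_D(10)[OF assms])
  finally show ?thesis by (simp add: eq_neg_iff_add_eq_0)
qed (use C2_D(2,3)[OF assms] in auto)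

lemma C2_eq_0:
  assumes \<phi>: "\<phi> \<in> C2 m"
    and basis: "\<And>i j. 1 \<le> i \<Longrightarrow> i \<le> 2*m+1 \<Longrightarrow> 1 \<le> j \<Longrightarrow> j \<le> 2*m+1 \<Longrightarrow> \<phi> (evec i) (evec j) = 0"
  shows "\<phi> = 0"
proof -
  note D = C2_D[OF \<phi>]
  have 1: "\<phi> (evec i) h = 0" if "1 \<le> i" "i \<le> 2*m+1" "h \<in> heis m" for i h
    by (rule additive_on_heis_eq_0[of m "\<phi> (evec i)"]) (use that D basis in auto)
  have "\<phi> g h = 0" if "g \<in> heis m" "h \<in> heis m" for g h
    by (rule additive_on_heis_eq_0[of m "\<lambda>g. \<phi> g h"]) (use that D 1 in auto)
  then show ?thesis using D(2,3) by (metis ext zero_fun_apply)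
qed

definition linear_cochain :: "nat \<Rightarrow> (nat \<Rightarrow> 'a::field vec) \<Rightarrow> 'a cochain1" where
  "linear_cochain m w g = (if g \<in> heis m then \<Sum>i=1..2*m+1. vscale (g i) (w i) else 0)"

lemma linear_cochain_C1:
  assumes "\<And>i. w i \<in> heis m"
  shows "linear_cochain m w \<in> C1 m"
proof -
  have "(\<Sum>i=1..2*m+1. vscale (g i) (w i)) \<in> heis m" for g :: "'a vec"
    using assms by (intro vec.subspace_sum[OF heis_subspace]) auto
  then show ?thesis
    by (simp add: C1_def linear_cochain_def vec.scale_left_distrib sum.distrib vec.scale_sum_right
        del: sum.cl_ivl_Suc) (simp add: vscale_def)
qed

lemma linear_cochain_evec:
  assumes "1 \<le> i" "i \<le> 2*m+1"
  shows "linear_cochain m w (evec i) = w i"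
proof -
  have "evec i \<in> heis m" using assms by simp
  then have "linear_cochain m w (evec i) = (\<Sum>j=1..2*m+1. vscale (evec i j) (w j))"
    unfolding linear_cochain_def by (rule if_P)
  also have "\<dots> = (\<Sum>j=1..2*m+1. if j = i then w j else 0)"
    by (rule sum.cong) (auto simp: evec_def vscale_def)
  finally show ?thesis using assms by (simp del: sum.cl_ivl_Suc)
qed

lemma d1_add: "d1 m (\<psi> + \<psi>') = d1 m \<psi> + d1 m \<psi>'"
  by (intro ext) (simp add: d1_def algebra_simps)

lemma d1_scale: "d1 m (scale1 a \<psi>) = scale2 a (d1 m \<psi>)"
  by (intro ext) (simp add: d1_def scale1_def scale2_def vec.scale_right_diff_distrib)

lemma d1_C2:
  assumes "\<psi> \<in> C1 m"
  shows "d1 m \<psi> \<in> C2 m"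
proof -
  note D = C1_D[OF assms]
  have 1: "d1 m \<psi> g \<in> C1 m" for g
    using D by (auto simp: C1_def d1_def vec.scale_right_diff_distrib)
  have "(\<lambda>g. d1 m \<psi> g h) = scale1 (-1) (d1 m \<psi> h)" for h
  proof
    fix g
    have "br m g h = vscale (-1) (br m h g)"
      by (simp add: br_eq sform_commute[of m g h])
    then have "g \<in> heis m \<Longrightarrow> h \<in> heis m \<Longrightarrow> \<psi> (br m g h) = vscale (-1) (\<psi> (br m h g))"
      using D(4)[of "br m h g" "-1"] by simp
    then show "d1 m \<psi> g h = scale1 (-1) (d1 m \<psi> h) g"
      by (simp add: d1_def scale1_def)
  qed
  then have 2: "(\<lambda>g. d1 m \<psi> g h) \<in> C1 m" for h
    using cochain1.subspace_scale[OF C1_subspace 1] by metis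
  show ?thesis
    using 1 2 D(5) by (auto simp: C2_def d1_def)
qed

lemma d2_add: "d2 m (\<phi> + \<phi>') = d2 m \<phi> + d2 m \<phi>'"
  by (intro ext) (simp add: d2_def)

lemma d2_scale: "d2 m (scale2 a \<phi>) = (\<lambda>g h k. vscale a (d2 m \<phi> g h k))"
  by (intro ext)
    (simp add: d2_def scale2_def vec.scale_right_diff_distrib vec.scale_right_distrib)

text \<open>
  Brackets are central, so in \<open>d\<^sup>2 (d\<^sup>1 \<psi>)\<close> all iterated brackets vanish and the remaining terms
  \<open>[g, \<psi> [h, k]]\<close> cancel in pairs.
\<close>

lemma d2_d1:
  assumes "\<psi> \<in> C1 m"
  shows "d2 m (d1 m \<psi>) = 0"
  using C1_D(5)[OF assms] by (intro ext) (simp add: d2_def d1_def)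

lemma Z2_subspace: "cochain2.subspace (Z2 m)"
proof -
  have "d2 m (0 :: 'a cochain2) = 0" by (intro ext) (auto simp: d2_def)
  moreover have zero: "(\<lambda>g h k. 0 :: 'a vec) = (0 :: 'a cochain3)" by (intro ext) simp
  ultimately show ?thesis
    unfolding Z2_def
    using cochain2.subspace_0[OF C2_subspace] cochain2.subspace_add[OF C2_subspace]
      cochain2.subspace_scale[OF C2_subspace]
    by (intro cochain2.subspaceI) (auto simp: d2_add d2_scale zero)
qed

lemma B2_subspace: "cochain2.subspace (B2 m)"
proof (rule cochain2.subspaceI)
  show "0 \<in> B2 m" unfolding B2_def
    by (rule image_eqI[of _ _ 0])
      (auto simp: d1_def fun_eq_iff cochain1.subspace_0[OF C1_subspace])
qed (auto simp: B2_def simp flip: d1_add d1_scale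
    intro!: imageI cochain1.subspace_add[OF C1_subspace] cochain1.subspace_scale[OF C1_subspace])

lemma B2_subset_Z2: "B2 m \<subseteq> Z2 m"
  by (auto simp: B2_def Z2_def d1_C2 d2_d1)

section \<open>Restricted cochains in characteristic 2\<close>

locale heisenberg_char2 =
  fixes m :: nat and lam :: "nat \<Rightarrow> 'a::field"
  assumes m_gt_1: "m > 1" and char2: "CHAR('a) = 2"
begin

lemma two_eq_0 [simp]: "(2 :: 'a) = 0"
  using of_nat_CHAR[where 'a = 'a] by (simp add: char2)

lemma double [simp]: "(x :: 'a) + x = 0"
  using mult_2[of x] by simp

lemma neg_eq [simp]: "- (x :: 'a) = x"
  using double[of x] by (simp add: eq_neg_iff_add_eq_0 flip: minus_unique)

lemma diff_eq [simp]: "(x :: 'a) - y = x + y"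
  using diff_conv_add_uminus[of x y] by simp

lemma double_left [simp]: "(x :: 'a) + (x + y) = y"
  by (simp add: add.assoc[symmetric])

lemma vec_char2 [simp]:
  "(v :: 'a vec) + v = 0" "v + (v + w) = w" "- v = v" "v - w = v + w"
  by (simp_all add: fun_eq_iff)

lemma square_add: "((x :: 'a) + y)\<^sup>2 = x\<^sup>2 + y\<^sup>2"
proof -
  have "(x + y)\<^sup>2 = x\<^sup>2 + y\<^sup>2 + (x * y + x * y)"
    by (simp add: power2_eq_square algebra_simps del: double double_left)
  then show ?thesis by simp
qed

lemma sform_sym: "sform m (g :: 'a vec) h = sform m h g"
  using sform_commute[of m g h] by simp

lemma pmap_scale: "pmap m lam (vscale a g) = vscale (a\<^sup>2) (pmap m lam g)"
  by (simp add: pmap_def vscale_def fun_eq_iff power_mult_distrib sum_distrib_left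
      distrib_left power2_eq_square mult_ac del: sum.cl_ivl_Suc)

text \<open>
  The quadratic form behind the \<open>[2]\<close>-map has the bracket as its polarization. This is what makes
  \<open>ind1\<close> compatible with \<open>d1\<close>.
\<close>

lemma pmap_add: "pmap m lam (g + h) = pmap m lam g + pmap m lam h + br m g h"
proof -
  have "(\<Sum>i=1..2*m+1. ((g + h) i)\<^sup>2 * lam i)
      = (\<Sum>i=1..2*m+1. (g i)\<^sup>2 * lam i) + (\<Sum>i=1..2*m+1. (h i)\<^sup>2 * lam i)"
    by (simp add: square_add distrib_right sum.distrib del: sum.cl_ivl_Suc)
  moreover have "(\<Sum>j=1..m. (g + h) j * (g + h) (m+j))
      = (\<Sum>j=1..m. g j * g (m+j)) + (\<Sum>j=1..m. h j * h (m+j)) + sform m g h"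
    by (simp add: sform_def sum.distrib[symmetric] algebra_simps)
  ultimately show ?thesis
    by (simp add: pmap_def br_eq vec.scale_left_distrib[symmetric] add_ac del: sum.cl_ivl_Suc)
qed

lemma pmap_evec:
  assumes "1 \<le> i" "i \<le> 2*m+1"
  shows "pmap m lam (evec i) = vscale (lam i) (evec (2*m+1))"
proof -
  have "(\<Sum>j=1..2*m+1. (evec i j)\<^sup>2 * lam j) = (\<Sum>j=1..2*m+1. if j = i then lam j else 0)"
    by (rule sum.cong) (auto simp: evec_def)
  moreover have "(\<Sum>j=1..m. evec i j * evec i (m+j)) = (0 :: 'a)"
    by (rule sum.neutral) (auto simp: evec_def)
  ultimately show ?thesis using assms by (simp add: pmap_def del: sum.cl_ivl_Suc)
qed

lemma compatible_D:
  assumes "compatible m \<phi> (\<omega> :: 'a vec \<Rightarrow> 'a vec)"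
  shows "\<omega> g \<in> heis m" "g \<notin> heis m \<Longrightarrow> \<omega> g = 0"
    "g \<in> heis m \<Longrightarrow> \<omega> (vscale a g) = vscale (a\<^sup>2) (\<omega> g)"
    "g \<in> heis m \<Longrightarrow> h \<in> heis m \<Longrightarrow> \<omega> (g + h) = \<omega> g + \<omega> h + \<phi> g h"
proof -
  show "\<omega> g \<in> heis m" using assms by (cases "g \<in> heis m") (auto simp: compatible_def)
qed (use assms in \<open>auto simp: compatible_def\<close>)

lemma compatible_add:
  "compatible m \<phi> (\<omega> :: 'a vec \<Rightarrow> 'a vec) \<Longrightarrow> compatible m \<phi>' \<omega>' \<Longrightarrow> compatible m (\<phi> + \<phi>') (\<omega> + \<omega>')"
  by (simp add: compatible_def vec.scale_right_distrib add_ac)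

lemma compatible_scale:
  "compatible m \<phi> (\<omega> :: 'a vec \<Rightarrow> 'a vec) \<Longrightarrow> compatible m (scale2 a \<phi>) (scale1 a \<omega>)"
  by (simp add: compatible_def scale1_def scale2_def vec.scale_right_distrib mult_ac)

lemma rC2_subspace: "rcochain2.subspace (rC2 m :: 'a rcochain2 set)"
proof (rule rcochain2.subspaceI)
  show "0 \<in> (rC2 m :: 'a rcochain2 set)"
    using cochain2.subspace_0[OF C2_subspace] by (simp add: rC2_def zero_prod_def compatible_def)
qed (auto simp: rC2_def rscale2_def compatible_add compatible_scale
    cochain2.subspace_add[OF C2_subspace] cochain2.subspace_scale[OF C2_subspace])

lemma ind2_add: "ind2 m lam (x + y) = ind2 m lam x + ind2 m lam y"
  by (cases x; cases y; intro ext) (simp add: ind2_def add_ac)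

lemma ind2_scale: "ind2 m lam (rscale2 a x) = (\<lambda>g h. vscale a (ind2 m lam x g h))"
  by (cases x; intro ext)
    (simp add: ind2_def rscale2_def scale1_def scale2_def vec.scale_right_distrib)

lemma rZ2_iff: "(\<phi>, \<omega>) \<in> rZ2 m lam \<longleftrightarrow> \<phi> \<in> Z2 m \<and> compatible m \<phi> \<omega> \<and> ind2 m lam (\<phi>, \<omega>) = 0"
  by (auto simp: rZ2_def rC2_def Z2_def rd2_def zero_prod_def)

lemma rZ2_subspace: "rcochain2.subspace (rZ2 m lam)"
proof (rule rcochain2.subspaceI)
  have "ind2 m lam 0 = 0" by (intro ext) (simp add: ind2_def zero_prod_def)
  then show "0 \<in> rZ2 m lam"
    using cochain2.subspace_0[OF Z2_subspace, of m] rcochain2.subspace_0[OF rC2_subspace]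
    by (simp add: rZ2_iff zero_prod_def rC2_def)
  fix x y assume "x \<in> rZ2 m lam" "y \<in> rZ2 m lam"
  then show "x + y \<in> rZ2 m lam"
    using ind2_add[of x y]
    by (cases x; cases y) (auto simp: rZ2_iff compatible_add cochain2.subspace_add[OF Z2_subspace])
next
  fix a x assume "x \<in> rZ2 m lam"
  moreover have zero: "(\<lambda>g h. 0) = (0 :: 'a cochain2)" by (intro ext) simp
  ultimately show "rscale2 a x \<in> rZ2 m lam"
    using ind2_scale[of a x]
    by (cases x) (auto simp: rZ2_iff rscale2_def compatible_scale zero
        cochain2.subspace_scale[OF Z2_subspace])
qed

text \<open>
  In \<open>ind\<^sup>2 (d\<^sup>1 \<psi>, ind\<^sup>1 \<psi>) (g, h)\<close> the term \<open>[g, \<psi>(h\<^sup>[\<^sup>2\<^sup>])]\<close> arises twice, and so does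
  \<open>[h, \<psi>[h, g]]\<close>. Each pair cancels in characteristic 2, and everything else is a bracket with a central element.
\<close>

lemma rd1_rZ2:
  assumes "\<psi> \<in> C1 m"
  shows "rd1 m lam \<psi> \<in> rZ2 m lam"
proof -
  note D = C1_D[OF assms]
  have "compatible m (d1 m \<psi>) (ind1 m lam \<psi>)"
    unfolding compatible_def
  proof (intro conjI ballI allI impI)
    fix g h :: "'a vec" assume gh: "g \<in> heis m" "h \<in> heis m"
    then show "ind1 m lam \<psi> (g + h) = ind1 m lam \<psi> g + ind1 m lam \<psi> h + d1 m \<psi> g h"
      using D by (simp add: ind1_def d1_def pmap_add add_ac)
  qed (use D in \<open>simp_all add: ind1_def pmap_scale vec.scale_right_distrib power2_eq_square\<close>)
  moreover have "ind2 m lam (d1 m \<psi>, ind1 m lam \<psi>) = 0"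
  proof (intro ext)
    fix g h k
    show "ind2 m lam (d1 m \<psi>, ind1 m lam \<psi>) g h k = 0 g h k"
      using D by (simp add: ind2_def ind1_def d1_def)
  qed
  ultimately show ?thesis
    using B2_subset_Z2 assms by (auto simp: rd1_def rZ2_iff B2_def)
qed

lemma ind1_add: "ind1 m lam (\<psi> + \<psi>') = ind1 m lam \<psi> + ind1 m lam \<psi>'"
  by (intro ext) (simp add: ind1_def add_ac)

lemma ind1_scale: "ind1 m lam (scale1 a \<psi>) = scale1 a (ind1 m lam \<psi>)"
  by (intro ext) (simp add: ind1_def scale1_def vec.scale_right_distrib)

lemma rB2_subspace: "rcochain2.subspace (rB2 m lam)"
proof (rule rcochain2.subspaceI)
  have "rd1 m lam 0 = 0"
    by (simp add: rd1_def zero_prod_def) (intro conjI ext; simp add: d1_def ind1_def)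
  then show "0 \<in> rB2 m lam"
    unfolding rB2_def using cochain1.subspace_0[OF C1_subspace, of m] by (metis imageI)
next
  fix x y assume "x \<in> rB2 m lam" "y \<in> rB2 m lam"
  then obtain \<psi> \<psi>' where "\<psi> \<in> C1 m" "\<psi>' \<in> C1 m" "x + y = rd1 m lam (\<psi> + \<psi>')"
    by (auto simp: rB2_def rd1_def d1_add ind1_add)
  then show "x + y \<in> rB2 m lam"
    using cochain1.subspace_add[OF C1_subspace] by (auto simp: rB2_def)
next
  fix a x assume "x \<in> rB2 m lam"
  then obtain \<psi> where "\<psi> \<in> C1 m" "rscale2 a x = rd1 m lam (scale1 a \<psi>)"
    by (auto simp: rB2_def rd1_def d1_scale ind1_scale rscale2_def)
  then show "rscale2 a x \<in> rB2 m lam"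
    using cochain1.subspace_scale[OF C1_subspace] by (auto simp: rB2_def)
qed

end

section \<open>Pivots and coordinates on cohomology\<close>

lemma prm_range: "1 \<le> i \<Longrightarrow> i \<le> 2*m \<Longrightarrow> 1 \<le> prm m i \<and> prm m i \<le> 2*m"
  by (auto simp: prm_def)

lemma prm_prm: "1 \<le> i \<Longrightarrow> i \<le> 2*m \<Longrightarrow> prm m (prm m i) = i"
  by (auto simp: prm_def)

lemma prm_eq_iff:
  "1 \<le> i \<Longrightarrow> i \<le> 2*m \<Longrightarrow> 1 \<le> j \<Longrightarrow> j \<le> 2*m \<Longrightarrow> prm m i = prm m j \<longleftrightarrow> i = j"
  by (metis prm_prm)

text \<open>
  The element of a three-element set of indices that the families \<open>A2\<close>, \<open>A3\<close>, \<open>A4\<close> single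
  out. The three alternatives are: \<open>p\<close> stands next to a pair \<open>{x, x'}\<close> (family \<open>A2\<close>); all three lie in
  one half and \<open>p\<close> is the smallest in the first half, or the largest in the second (family \<open>A3\<close>);
  \<open>x\<close> and \<open>y\<close> lie in one half and \<open>p\<close> in the other, with no conjugate pair (family \<open>A4\<close>).
\<close>

definition pivot :: "nat \<Rightarrow> nat \<Rightarrow> nat \<Rightarrow> nat \<Rightarrow> bool" where
  "pivot m p x y \<longleftrightarrow> p \<noteq> x \<and> p \<noteq> y \<and> x \<noteq> y \<and> {p, x, y} \<subseteq> {1..2*m} \<and>
     (y = prm m x \<or>
      same_half m {p, x, y} \<and> (if p \<le> m then p < x \<and> p < y else x < p \<and> y < p) \<or>
      same_half m {prm m p, x, y} \<and> prm m p \<noteq> x \<and> prm m p \<noteq> y)"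

lemma same_half_iff:
  "same_half m {a, b, c} \<longleftrightarrow> 1 \<le> a \<and> 1 \<le> b \<and> 1 \<le> c \<and> a \<le> 2*m \<and> b \<le> 2*m \<and> c \<le> 2*m \<and>
     (a \<le> m \<longleftrightarrow> b \<le> m) \<and> (a \<le> m \<longleftrightarrow> c \<le> m)"
  by (auto simp: same_half_def)

lemma pivot_range:
  assumes "pivot m p x y"
  shows "1 \<le> p" "p \<le> 2*m" "1 \<le> x" "x \<le> 2*m" "1 \<le> y" "y \<le> 2*m" "p \<noteq> x" "p \<noteq> y" "x \<noteq> y"
  using assms by (auto simp: pivot_def)

lemma pivot_commute: "pivot m p x y \<longleftrightarrow> pivot m p y x"
  by (auto simp: pivot_def same_half_iff prm_prm)

lemma prm_half: "1 \<le> i \<Longrightarrow> i \<le> 2*m \<Longrightarrow> prm m i \<le> m \<longleftrightarrow> \<not> i \<le> m"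
  by (auto simp: prm_def)

lemma pivot_cases:
  assumes "pivot m p x y"
  shows "y = prm m x \<or>
    (p \<le> m \<longleftrightarrow> x \<le> m) \<and> (p \<le> m \<longleftrightarrow> y \<le> m) \<and> (if p \<le> m then p < x else x < p) \<or>
    (p \<le> m \<longleftrightarrow> \<not> x \<le> m) \<and> (p \<le> m \<longleftrightarrow> \<not> y \<le> m) \<and> prm m p \<noteq> y"
proof -
  have "prm m p \<le> m \<longleftrightarrow> \<not> p \<le> m" using pivot_range(1,2)[OF assms] by (rule prm_half)
  then show ?thesis using assms unfolding pivot_def same_half_iff by (cases "p \<le> m") auto
qed

lemma pivot_unique:
  assumes "pivot m p x y"
  shows "\<not> pivot m x p y"
proof
  assume xpy: "pivot m x p y"
  note range = pivot_range[OF assms]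
  have "prm m p \<le> m \<longleftrightarrow> \<not> p \<le> m" "prm m x \<le> m \<longleftrightarrow> \<not> x \<le> m"
    using range prm_half by auto
  moreover have "prm m x \<noteq> prm m p" using range by (simp add: prm_eq_iff)
  ultimately show False
    using pivot_cases[OF assms] pivot_cases[OF xpy] by (metis not_less_iff_gr_or_eq)
qed

lemma pivot_exists:
  assumes "a \<noteq> b" "a \<noteq> c" "b \<noteq> c" "{a, b, c} \<subseteq> {1..2*m}"
  shows "pivot m a b c \<or> pivot m b a c \<or> pivot m c a b"
proof -
  consider "b = prm m a \<or> c = prm m a \<or> c = prm m b"
    | "b \<noteq> prm m a" "c \<noteq> prm m a" "c \<noteq> prm m b" "same_half m {a, b, c}"
    | "b \<noteq> prm m a" "c \<noteq> prm m a" "c \<noteq> prm m b" "\<not> same_half m {a, b, c}"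
    by blast
  then show ?thesis
  proof cases
    case 1
    then show ?thesis using assms by (auto simp: pivot_def prm_prm)
  next
    case 2
    have "(if a \<le> m then a < b \<and> a < c else b < a \<and> c < a) \<or>
        (if b \<le> m then b < a \<and> b < c else a < b \<and> c < b) \<or>
        (if c \<le> m then c < a \<and> c < b else a < c \<and> b < c)"
      using assms 2 unfolding same_half_iff by (cases "a \<le> m") auto
    moreover have "same_half m {b, a, c}" "same_half m {c, a, b}"
      using 2 by (auto simp: same_half_def)
    ultimately have "(if a \<le> m then a < b \<and> a < c else b < a \<and> c < a) \<and> same_half m {a, b, c} \<or>
        (if b \<le> m then b < a \<and> b < c else a < b \<and> c < b) \<and> same_half m {b, a, c} \<or>
        (if c \<le> m then c < a \<and> c < b else a < c \<and> b < c) \<and> same_half m {c, a, b}"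
      using 2(4) by blast
    moreover have "{b, a, c} \<subseteq> {1..2*m}" "{c, a, b} \<subseteq> {1..2*m}" using assms(4) by auto
    ultimately show ?thesis using assms unfolding pivot_def by blast
  next
    case 3
    have "b \<le> m \<longleftrightarrow> \<not> prm m b \<le> m" "a \<le> m \<longleftrightarrow> \<not> prm m a \<le> m" "c \<le> m \<longleftrightarrow> \<not> prm m c \<le> m"
      using assms prm_half by auto
    then have "same_half m {prm m a, b, c} \<or> same_half m {prm m b, a, c} \<or> same_half m {prm m c, a, b}"
      using assms 3(4) prm_range[of a m] prm_range[of b m] prm_range[of c m]
      unfolding same_half_iff by auto
    moreover have "a \<noteq> prm m b" "a \<noteq> prm m c" "b \<noteq> prm m c"
      using 3 assms prm_prm by auto
    moreover have "{b, a, c} \<subseteq> {1..2*m}" "{c, a, b} \<subseteq> {1..2*m}" using assms(4) by auto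
    ultimately show ?thesis using assms 3(1-3) unfolding pivot_def by metis
  qed
qed

text \<open>
  A triple \<open>(p, x, y)\<close> stands for the coefficient of \<open>e\<^sub>x\<^sub>'\<close> in \<open>\<phi>(e\<^sub>p, e\<^sub>y)\<close>. The triples
  \<open>(x, x, y)\<close> belong to \<open>A1\<close>. For the others \<open>x\<close> is not the pivot of \<open>{p, x, y}\<close>, as a cyclic
  relation determines the coefficient at the pivot.
\<close>

definition cocycle_index :: "nat \<Rightarrow> (nat \<times> nat \<times> nat) set" where
  "cocycle_index m = {(x, x, y) | x y. x \<noteq> y \<and> {x, y} \<subseteq> {1..2*m}} \<union> {(p, x, y) | p x y. pivot m p x y}"

lemma finite_cocycle_index: "finite (cocycle_index m)"
proof (rule finite_subset)
  show "cocycle_index m \<subseteq> {1..2*m} \<times> {1..2*m} \<times> {1..2*m}"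
    by (auto simp: cocycle_index_def pivot_def)
qed simp

text \<open>
  The second summand corrects the bare coefficient so that coboundaries are killed. If \<open>\<psi>(z) = v\<close>,
  then \<open>d\<^sup>1 \<psi>\<close> contributes the \<open>e\<^sub>x\<^sub>'\<close>-coefficient of \<open>- \<sigma>(e\<^sub>p, e\<^sub>y) v\<close> to the first summand, and
  the same coefficient of \<open>v\<close> is, up to sign, the \<open>z\<close>-component of \<open>d\<^sup>1 \<psi> (e\<^sub>x, z) = [e\<^sub>x, v]\<close>.
\<close>

definition coord :: "nat \<Rightarrow> nat \<times> nat \<times> nat \<Rightarrow> 'a::field cochain2 \<Rightarrow> 'a" where
  "coord m = (\<lambda>(p, x, y) \<phi>. \<phi> (evec p) (evec y) (prm m x)
     + sform m (evec p) (evec y) * \<phi> (evec x) (evec (2*m+1)) (2*m+1))"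

lemma coord_add: "coord m t (\<phi> + \<phi>') = coord m t \<phi> + coord m t \<phi>'"
  by (cases t) (simp add: coord_def algebra_simps)

lemma coord_scale: "coord m t (scale2 a \<phi>) = a * coord m t \<phi>"
  by (cases t) (simp add: coord_def scale2_def vscale_def algebra_simps)

lemma sform_evec_left:
  assumes "1 \<le> i" "i \<le> 2*m"
  shows "sform m (evec i) h = (if i \<le> m then h (prm m i) else - h (prm m i))"
proof -
  have "sform m (evec i) h
      = (\<Sum>j=1..m. if j = i then h (m+j) else 0) - (\<Sum>j=1..m. if j = i - m then h j else 0)"
    if "m < i"
    unfolding sform_def sum_subtractf[symmetric]
    by (rule sum.cong) (use that assms in \<open>auto simp: evec_def\<close>)
  moreover have "sform m (evec i) h = (\<Sum>j=1..m. if j = i then h (m+j) else 0)" if "i \<le> m"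
    unfolding sform_def by (rule sum.cong) (use that assms in \<open>auto simp: evec_def\<close>)
  ultimately show ?thesis
    using assms by (cases "i \<le> m") (auto simp: prm_def add.commute)
qed

context heisenberg_char2
begin

abbreviation center :: "'a vec" where "center \<equiv> evec (Suc (2*m))"

lemma sform_evec:
  assumes "1 \<le> i" "i \<le> 2*m"
  shows "sform m (evec i) h = (h (prm m i) :: 'a)" "sform m h (evec i) = (h (prm m i) :: 'a)"
  using sform_evec_left[OF assms, of h] by (simp_all add: sform_sym[of h])

lemma br_apply: "br m g h k = (if k = Suc (2*m) then sform m g h else 0)"
  by (simp add: br_eq vscale_def evec_def)

lemma coord_d1:
  assumes "t \<in> cocycle_index m" "\<psi> \<in> C1 m"
  shows "coord m t (d1 m \<psi> :: 'a cochain2) = 0"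
proof -
  obtain p x y where t: "t = (p, x, y)" by (cases t)
  then have *: "1 \<le> p" "p \<le> 2*m" "1 \<le> x" "x \<le> 2*m" "1 \<le> y" "y \<le> 2*m"
    using assms(1) by (auto simp: cocycle_index_def pivot_def)
  then have "prm m x \<noteq> Suc (2*m)" using prm_range[of x m] by auto
  then have "d1 m \<psi> (evec p) (evec y) (prm m x) = sform m (evec p) (evec y) * \<psi> center (prm m x)"
    using * C1_D[OF assms(2)] by (simp add: d1_def br_apply) (simp add: br_eq vscale_def)
  moreover have "d1 m \<psi> (evec x) center (Suc (2*m)) = \<psi> center (prm m x)"
    using * C1_D[OF assms(2)] by (simp add: d1_def br_apply sform_evec)
  ultimately show ?thesis by (simp add: t coord_def)
qed

lemma Z2_D:
  assumes "\<phi> \<in> Z2 m" "g \<in> heis m" "h \<in> heis m" "k \<in> heis m"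
  shows "br m g (\<phi> h k) + br m h (\<phi> g k) + br m k (\<phi> g h)
           + \<phi> (br m g h) k + \<phi> (br m g k) h + \<phi> (br m h k) g = (0 :: 'a vec)"
proof -
  have "d2 m \<phi> g h k = 0" using assms by (simp add: Z2_def)
  then show ?thesis using assms by (simp add: d2_def)
qed

text \<open>
  With \<open>[e\<^sub>i, e\<^sub>i\<^sub>'] = z\<close> and \<open>x\<close> different from \<open>i\<close> and \<open>i'\<close>, the cocycle identity at
  \<open>e\<^sub>i, e\<^sub>i\<^sub>', e\<^sub>x\<close> expresses \<open>\<phi>(z, e\<^sub>x)\<close> by brackets, which are multiples of \<open>z\<close>. Such an \<open>i\<close>
  exists because \<open>m > 1\<close>.
\<close>

lemma Z2_center_line:
  assumes \<phi>: "\<phi> \<in> Z2 m" and x: "1 \<le> x" "x \<le> 2*m" and k: "k \<noteq> Suc (2*m)"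
  shows "\<phi> (evec x) center k = (0 :: 'a)"
proof -
  define i where "i = (if x = 1 \<or> x = m + 1 then 2 else 1 :: nat)"
  have i: "1 \<le> i" "i \<le> m" "i \<noteq> x" "m + i \<noteq> x" using m_gt_1 by (auto simp: i_def)
  have C2: "\<phi> \<in> C2 m" using \<phi> by (simp add: Z2_def)
  have "sform m (evec i) (evec (m+i)) = (1 :: 'a)" "sform m (evec i) (evec x) = (0 :: 'a)"
    "sform m (evec (m+i)) (evec x) = (0 :: 'a)"
    using i x by (subst sform_evec(1); auto simp: evec_def prm_def)+
  then have "br m (evec i) (evec (m+i)) = center" "br m (evec i) (evec x) = (0 :: 'a vec)"
    "br m (evec (m+i)) (evec x) = (0 :: 'a vec)"
    by (simp_all add: br_eq)
  then have "br m (evec i) (\<phi> (evec (m+i)) (evec x)) + br m (evec (m+i)) (\<phi> (evec i) (evec x))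
      + br m (evec x) (\<phi> (evec i) (evec (m+i))) + \<phi> center (evec x) = 0"
    using Z2_D[OF \<phi>, of "evec i" "evec (m+i)" "evec x"] i x C2_D(8)[OF C2] by simp
  from fun_cong[OF this, of k] have "\<phi> center (evec x) k = 0"
    using k by (simp add: br_apply)
  then show ?thesis using C2_antisym[OF C2, of "evec x" center] by simp
qed

text \<open>
  Once \<open>\<phi>\<close> vanishes on the centre, only the terms \<open>[e\<^sub>a, \<phi>(e\<^sub>b, e\<^sub>c)]\<close> of the cocycle identity
  remain, and bracketing with \<open>e\<^sub>a\<close> picks out the coefficient of \<open>e\<^sub>a\<^sub>'\<close>.
\<close>

lemma Z2_cyclic:
  assumes \<phi>: "\<phi> \<in> Z2 m" and center: "\<And>x. 1 \<le> x \<Longrightarrow> x \<le> 2*m \<Longrightarrow> \<phi> (evec x) center = 0"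
    and abc: "1 \<le> a" "a \<le> 2*m" "1 \<le> b" "b \<le> 2*m" "1 \<le> c" "c \<le> 2*m"
  shows "\<phi> (evec b) (evec c) (prm m a) + \<phi> (evec a) (evec c) (prm m b)
    + \<phi> (evec a) (evec b) (prm m c) = (0 :: 'a)"
proof -
  have C2: "\<phi> \<in> C2 m" using \<phi> by (simp add: Z2_def)
  have "\<phi> (br m g h) (evec x) = 0" if "1 \<le> x" "x \<le> 2*m" for g h x
    using C2_antisym[OF C2, of center "evec x"] center[OF that] C2_D(6)[OF C2, of center]
    by (simp add: br_eq)
  then have "br m (evec a) (\<phi> (evec b) (evec c)) + br m (evec b) (\<phi> (evec a) (evec c))
      + br m (evec c) (\<phi> (evec a) (evec b)) = 0"
    using Z2_D[OF \<phi>, of "evec a" "evec b" "evec c"] abc by simp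
  from fun_cong[OF this, of "Suc (2*m)"] show ?thesis
    using abc by (simp add: br_apply sform_evec)
qed

text \<open>
  The coordinates give all coefficients in \<open>V\<close> except those at pivots, and the cyclic relation gives
  the latter.
\<close>

lemma Z2_eq_0:
  assumes \<phi>: "\<phi> \<in> Z2 m"
    and coord: "\<And>t. t \<in> cocycle_index m \<Longrightarrow> coord m t \<phi> = 0"
    and center: "\<And>x. 1 \<le> x \<Longrightarrow> x \<le> 2*m \<Longrightarrow> \<phi> (evec x) center (Suc (2*m)) = 0"
    and top: "\<And>a b. 1 \<le> a \<Longrightarrow> a < b \<Longrightarrow> b \<le> 2*m \<Longrightarrow> \<phi> (evec a) (evec b) (Suc (2*m)) = 0"
  shows "\<phi> = (0 :: 'a cochain2)"
proof -
  have C2: "\<phi> \<in> C2 m" using \<phi> by (simp add: Z2_def)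
  have sym: "\<phi> g h = \<phi> h g" for g h using C2_antisym[OF C2, of g h] by simp
  have center': "\<phi> (evec x) center = 0" if "1 \<le> x" "x \<le> 2*m" for x
  proof
    fix k show "\<phi> (evec x) center k = 0 k"
      using Z2_center_line[OF \<phi> that] center[OF that] by (cases "k = Suc (2*m)") auto
  qed
  have J: "\<phi> (evec p) (evec y) (prm m x) = 0" if "(p, x, y) \<in> cocycle_index m" for p x y
  proof -
    have "1 \<le> x" "x \<le> 2*m" using that by (auto simp: cocycle_index_def pivot_def)
    then show ?thesis using coord[OF that] center[of x] by (simp add: coord_def)
  qed
  have V: "\<phi> (evec a) (evec b) (prm m c) = 0"
    if abc: "1 \<le> a" "a \<le> 2*m" "1 \<le> b" "b \<le> 2*m" "1 \<le> c" "c \<le> 2*m" for a b c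
  proof -
    consider "a = b" | "a \<noteq> b" "c = a" | "a \<noteq> b" "c = b" | "a \<noteq> b" "c \<noteq> a" "c \<noteq> b" by blast
    then show ?thesis
    proof cases
      case 4
      then consider "pivot m a c b" | "pivot m b c a" | "pivot m c a b"
        using pivot_exists[of a b c m] abc by (auto simp: pivot_commute)
      then show ?thesis
      proof cases
        case 3
        then have "pivot m c b a" by (simp add: pivot_commute)
        then have "\<phi> (evec c) (evec b) (prm m a) = 0" "\<phi> (evec c) (evec a) (prm m b) = 0"
          using 3 J by (auto simp: cocycle_index_def)
        then show ?thesis
          using Z2_cyclic[OF \<phi> center' abc] sym by simp
      qed (use J[of a c b] J[of b c a] sym[of "evec a" "evec b"] in \<open>auto simp: cocycle_index_def\<close>)
    qed (use abc J[of a a b] J[of b b a] sym[of "evec a" "evec b"] C2_D(10)[OF C2]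
        in \<open>auto simp: cocycle_index_def\<close>)
  qed
  have "\<phi> (evec a) (evec b) = 0" if ab: "1 \<le> a" "a \<le> 2*m" "1 \<le> b" "b \<le> 2*m" for a b
  proof
    fix k
    consider "k \<notin> {1..2*m+1}" | "k = Suc (2*m)" | "1 \<le> k" "k \<le> 2*m" by (auto simp: le_Suc_eq)
    then show "\<phi> (evec a) (evec b) k = 0 k"
    proof cases
      case 1
      then show ?thesis using C2_D(1)[OF C2] by (simp add: heis_def)
    next
      case 2
      then show ?thesis
        using top[of a b] top[of b a] ab sym C2_D(10)[OF C2]
        by (cases a b rule: linorder_cases) auto
    next
      case 3
      then show ?thesis using V[OF ab, of "prm m k"] prm_range prm_prm by simp
    qed
  qed
  moreover have "\<phi> center (evec x) = 0" "\<phi> (evec x) center = 0" if "1 \<le> x" "x \<le> 2*m" for x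
    using center'[OF that] sym by auto
  ultimately show ?thesis
    using C2_D(10)[OF C2] by (intro C2_eq_0[OF C2]) (auto simp: le_Suc_eq)
qed

text \<open>
  The \<open>z\<close>-component of \<open>d\<^sup>1 \<psi>\<close> on the span of \<open>e\<^sub>1, \<dots>, e\<^sub>2\<^sub>m\<close> is the alternating form
  \<open>\<sigma>(g, \<psi>(h)) + \<sigma>(h, \<psi>(g)) + c \<sigma>(g, h)\<close>. The diagonal \<open>d\<close> of \<open>\<sigma>(g, \<psi>(h))\<close> does not enter it, and
  the off-diagonal entries compensate for any \<open>c\<close>. The free choice of \<open>c\<close> and \<open>d\<close> serves to match
  \<open>\<omega>\<close> in the restricted case.
\<close>

lemma coboundary_if_coord_0:
  assumes \<phi>: "\<phi> \<in> Z2 m" and coord: "\<And>t. t \<in> cocycle_index m \<Longrightarrow> coord m t \<phi> = 0"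
  shows "\<exists>\<psi>\<in>C1 m. d1 m \<psi> = \<phi> \<and> \<psi> center (Suc (2*m)) = (c :: 'a) \<and>
    (\<forall>i. 1 \<le> i \<longrightarrow> i \<le> 2*m \<longrightarrow> \<psi> (evec i) (prm m i) = d i)"
proof -
  \<comment> \<open>\<open>b\<close> is the matrix of \<open>\<sigma>(e\<^sub>i, \<psi>(e\<^sub>j))\<close>: the strictly upper triangular part carries the whole
    alternating form, and the diagonal is free. The column \<open>w j\<close> is the resulting value \<open>\<psi>(e\<^sub>j)\<close>.\<close>
  define b where "b i j = (if i = j then d i
     else if i < j then \<phi> (evec i) (evec j) (Suc (2*m)) + c * sform m (evec i) (evec j) else 0)" for i j
  define w where "w j k = (if k \<notin> {1..2*m+1} then 0
     else if j = Suc (2*m) then if k = Suc (2*m) then c else \<phi> (evec (prm m k)) center (Suc (2*m))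
     else if k = Suc (2*m) then 0 else b (prm m k) j)" for j k
  define \<psi> where "\<psi> = linear_cochain m w"
  have \<psi>: "\<psi> \<in> C1 m" unfolding \<psi>_def by (rule linear_cochain_C1) (auto simp: heis_def w_def)
  have evec: "\<psi> (evec i) = w i" if "1 \<le> i" "i \<le> 2*m+1" for i
    using linear_cochain_evec that by (simp add: \<psi>_def)
  have b: "\<psi> (evec j) (prm m i) = b i j" if "1 \<le> i" "i \<le> 2*m" "1 \<le> j" "j \<le> 2*m" for i j
    using that prm_range[of i m] prm_prm[of i m] by (auto simp: evec w_def)
  have v: "\<psi> center (prm m i) = \<phi> (evec i) center (Suc (2*m))" if "1 \<le> i" "i \<le> 2*m" for i
    using that prm_range[of i m] prm_prm[of i m] by (auto simp: evec w_def)
  have c: "\<psi> center (Suc (2*m)) = c" by (simp add: evec w_def)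
  have "\<phi> - d1 m \<psi> = 0"
  proof (rule Z2_eq_0)
    have B2: "d1 m \<psi> \<in> B2 m" using \<psi> by (simp add: B2_def)
    then show "\<phi> - d1 m \<psi> \<in> Z2 m"
      using \<phi> B2_subset_Z2 by (intro cochain2.subspace_diff[OF Z2_subspace]) auto
    show "coord m t (\<phi> - d1 m \<psi>) = 0" if "t \<in> cocycle_index m" for t
      using coord_add[of m t "\<phi> - d1 m \<psi>" "d1 m \<psi>"] coord[OF that] coord_d1[OF that \<psi>] by simp
    show "(\<phi> - d1 m \<psi>) (evec x) center (Suc (2*m)) = 0" if "1 \<le> x" "x \<le> 2*m" for x
      using that v C1_D(5)[OF \<psi>] by (simp add: d1_def br_apply sform_evec)
    show "(\<phi> - d1 m \<psi>) (evec i) (evec j) (Suc (2*m)) = 0" if "1 \<le> i" "i < j" "j \<le> 2*m" for i j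
    proof -
      have "\<psi> (br m (evec i) (evec j)) (Suc (2*m)) = sform m (evec i) (evec j) * c"
        using C1_D(4)[OF \<psi>, of center] c by (simp add: br_eq vscale_def)
      then show ?thesis
        using that by (simp add: d1_def br_apply sform_evec(1)[of _ "\<psi> _"] b b_def mult.commute)
    qed
  qed
  then show ?thesis using \<psi> c b by (intro bexI[of _ \<psi>]) (simp_all add: b_def)
qed

text \<open>
  A map \<open>\<psi>\<close> with \<open>d\<^sup>1 \<psi> = \<phi>\<close> is chosen so that \<open>ind\<^sup>1 \<psi>\<close> and \<open>\<omega>\<close> have the same \<open>z\<close>-components on
  basis vectors. The difference \<open>(0, \<delta>)\<close> is again a restricted cocycle, so \<open>[g, \<delta>(h)] = 0\<close> for all
  \<open>g\<close>; hence \<open>\<delta>\<close> has values in the centre and therefore vanishes.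
\<close>

lemma restricted_coboundary_if_coord_0:
  assumes x: "(\<phi>, \<omega>) \<in> rZ2 m lam"
    and coord: "\<And>t. t \<in> cocycle_index m \<Longrightarrow> coord m t \<phi> = 0"
    and center: "lam (2*m+1) = 0 \<Longrightarrow> \<omega> center (Suc (2*m)) = 0"
  shows "(\<phi>, \<omega>) \<in> rB2 m lam"
proof -
  \<comment> \<open>If \<open>\<lambda>\<^sub>2\<^sub>m\<^sub>+\<^sub>1 = 0\<close>, the quotient is \<open>0\<close>, and the identity below is the assumption on \<open>\<omega>(z)\<close>.\<close>
  define c where "c = \<omega> center (Suc (2*m)) / lam (Suc (2*m))"
  have c: "c * lam (Suc (2*m)) = \<omega> center (Suc (2*m))" using center by (simp add: c_def)
  have "\<phi> \<in> Z2 m" using x by (simp add: rZ2_iff)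
  then obtain \<psi> where \<psi>: "\<psi> \<in> C1 m" "d1 m \<psi> = \<phi>" "\<psi> center (Suc (2*m)) = c"
    and diag: "\<And>i. 1 \<le> i \<Longrightarrow> i \<le> 2*m \<Longrightarrow>
      \<psi> (evec i) (prm m i) = \<omega> (evec i) (Suc (2*m)) + c * lam i"
    using coboundary_if_coord_0[OF _ coord, where c = c
        and d = "\<lambda>i. \<omega> (evec i) (Suc (2*m)) + c * lam i"] by blast
  define \<delta> where "\<delta> = \<omega> - ind1 m lam \<psi>"
  have "(\<phi>, \<omega>) - rd1 m lam \<psi> \<in> rZ2 m lam"
    using x rd1_rZ2[OF \<psi>(1)] by (intro rcochain2.subspace_diff[OF rZ2_subspace])
  then have "(0, \<delta>) \<in> rZ2 m lam" by (simp add: rd1_def \<psi>(2) \<delta>_def)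
  then have comp: "compatible m 0 \<delta>" and ind2: "ind2 m lam (0, \<delta>) = 0" by (auto simp: rZ2_iff)
  note D = compatible_D[OF comp]
  have pm: "\<psi> (pmap m lam (evec i)) (Suc (2*m)) = c * lam i" if "1 \<le> i" "i \<le> Suc (2*m)" for i
    using that \<psi>(3) C1_D(4)[OF \<psi>(1), of center] by (simp add: pmap_evec vscale_def mult.commute[of c])
  have \<delta>_evec: "\<delta> (evec i) = 0" if i: "1 \<le> i" "i \<le> Suc (2*m)" for i
  proof
    fix k
    consider "k \<notin> {1..2*m+1}" | "1 \<le> k" "k \<le> 2*m" | "k = Suc (2*m)" by (auto simp: le_Suc_eq)
    then show "\<delta> (evec i) k = 0 k"
    proof cases
      case 1
      then show ?thesis using D(1)[of "evec i"] by (simp add: heis_def)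
    next
      case 2
      have "br m (evec (prm m k)) (\<delta> (evec i)) = 0"
        using fun_cong[OF fun_cong[OF ind2], of "evec (prm m k)" "evec i"] i prm_range[OF 2]
        by (simp add: ind2_def)
      from fun_cong[OF this, of "Suc (2*m)"] show ?thesis
        using prm_range[OF 2] prm_prm[OF 2] by (simp add: br_apply sform_evec)
    next
      case 3
      then show ?thesis
      proof (cases "i = Suc (2*m)")
        case True
        then show ?thesis
          using 3 pm[of "Suc (2*m)"] c by (simp add: \<delta>_def ind1_def br_apply)
      next
        case False
        then have "1 \<le> i" "i \<le> 2*m" using i by auto
        then show ?thesis
          using 3 pm[OF i] diag by (simp add: \<delta>_def ind1_def br_apply sform_evec add_ac)
      qed
    qed
  qed
  have "\<delta> g = 0" if g: "g \<in> heis m" for g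
  proof (rule additive_on_heis_eq_0[OF _ _ g])
    show "\<delta> (g + h) = \<delta> g + \<delta> h" if "g \<in> heis m" "h \<in> heis m" for g h
      using D(4)[OF that] by simp
    show "\<delta> (vscale a (evec i)) = 0" if "1 \<le> i" "i \<le> 2*m+1" for a i
      using D(3)[of "evec i" a] that by (simp add: \<delta>_evec)
  qed
  then have "\<delta> = 0" using D(2) by (intro ext) (metis zero_fun_apply)
  then have "\<omega> = ind1 m lam \<psi>" by (simp only: \<delta>_def right_minus_eq)
  then have "(\<phi>, \<omega>) = rd1 m lam \<psi>" using \<psi>(2) by (simp add: rd1_def)
  then show ?thesis using \<psi>(1) by (auto simp: rB2_def)
qed

end

section \<open>The explicit cocycles\<close>

text \<open>
  Indexing the value by \<open>c\<close> instead of \<open>c'\<close> turns \<open>\<sigma>(k, e\<^sub>c\<^sub>')\<close> into the coordinate \<open>k\<^sub>c\<close>, so that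
  \<open>d\<^sup>2\<close> of this cochain is the 3 by 3 determinant of the coordinates \<open>a, b, c\<close>.
\<close>

definition basic_cochain :: "nat \<Rightarrow> nat \<Rightarrow> nat \<Rightarrow> nat \<Rightarrow> 'a::field cochain2" where
  "basic_cochain m a b c = ecoch m a b (prm m c)"

text \<open>
  The compatible map that belongs to \<open>basic_cochain\<close> and vanishes on the basis vectors (for \<open>a \<noteq> b\<close>).
\<close>

definition basic_square :: "nat \<Rightarrow> nat \<Rightarrow> nat \<Rightarrow> nat \<Rightarrow> 'a::field vec \<Rightarrow> 'a vec" where
  "basic_square m a b c = (\<lambda>g. if g \<in> heis m then vscale (g a * g b) (evec (prm m c)) else 0)"

definition cocycle :: "nat \<Rightarrow> nat \<times> nat \<times> nat \<Rightarrow> 'a::field cochain2" where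
  "cocycle m = (\<lambda>(p, x, y). if p = x then basic_cochain m x y x
     else basic_cochain m p y x + basic_cochain m x y p)"

definition cocycle_square :: "nat \<Rightarrow> nat \<times> nat \<times> nat \<Rightarrow> 'a::field vec \<Rightarrow> 'a vec" where
  "cocycle_square m = (\<lambda>(p, x, y). if p = x then basic_square m x y x + ebar m x (prm m y)
     else basic_square m p y x + basic_square m x y p)"

definition rcocycle :: "nat \<Rightarrow> nat \<times> nat \<times> nat \<Rightarrow> 'a::field rcochain2" where
  "rcocycle m t = (cocycle m t, cocycle_square m t)"

lemma cocycle_index_range:
  assumes "(p, x, y) \<in> cocycle_index m"
  shows "1 \<le> p" "p \<le> 2*m" "1 \<le> x" "x \<le> 2*m" "1 \<le> y" "y \<le> 2*m" "x \<noteq> y" "p \<noteq> y"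
  using assms by (auto simp: cocycle_index_def pivot_def)

context heisenberg_char2
begin

lemma basic_cochain_C2:
  assumes "1 \<le> c" "c \<le> 2*m"
  shows "basic_cochain m a b c \<in> (C2 m :: 'a cochain2 set)"
proof -
  let ?\<phi> = "basic_cochain m a b c :: 'a cochain2"
  have right: "?\<phi> g \<in> C1 m" for g
    unfolding C1_def
  proof (intro CollectI conjI ballI allI impI)
    fix h h' :: "'a vec" assume "h \<in> heis m" "h' \<in> heis m"
    then show "?\<phi> g (h + h') = ?\<phi> g h + ?\<phi> g h'"
      by (simp add: basic_cochain_def ecoch_def vec.scale_left_distrib[symmetric] distrib_left add_ac)
  next
    fix s and h :: "'a vec" assume "h \<in> heis m"
    then show "?\<phi> g (vscale s h) = vscale s (?\<phi> g h)"
      by (simp add: basic_cochain_def ecoch_def) (simp add: vscale_def distrib_left mult_ac)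
  qed (use prm_range[OF assms] in \<open>simp_all add: basic_cochain_def ecoch_def\<close>)
  have "?\<phi> g h = ?\<phi> h g" for g h
    by (simp add: basic_cochain_def ecoch_def add.commute mult.commute)
  then have "(\<lambda>g. ?\<phi> g h) = ?\<phi> h" for h by blast
  then show ?thesis
    using right by (simp add: C2_def) (simp add: basic_cochain_def ecoch_def mult.commute)
qed

lemma compatible_basic:
  assumes "1 \<le> c" "c \<le> 2*m"
  shows "compatible m (basic_cochain m a b c) (basic_square m a b c :: 'a vec \<Rightarrow> 'a vec)"
  unfolding compatible_def
proof (intro conjI ballI allI impI)
  fix g h :: "'a vec" assume "g \<in> heis m" "h \<in> heis m"
  then show "basic_square m a b c (g + h)
      = basic_square m a b c g + basic_square m a b c h + basic_cochain m a b c g h"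
    by (simp add: basic_cochain_def basic_square_def ecoch_def vec.scale_left_distrib[symmetric]
        distrib_left distrib_right add_ac mult_ac)
next
  fix s and g :: "'a vec" assume "g \<in> heis m"
  then show "basic_square m a b c (vscale s g) = vscale (s\<^sup>2) (basic_square m a b c g)"
    by (simp add: basic_square_def) (simp add: vscale_def power2_eq_square mult_ac)
qed (use prm_range[OF assms] in \<open>simp_all add: basic_square_def\<close>)

lemma compatible_ebar:
  assumes "1 \<le> k" "k \<le> 2*m+1"
  shows "compatible m 0 (ebar m i k :: 'a vec \<Rightarrow> 'a vec)"
  unfolding compatible_def
proof (intro conjI ballI allI impI)
  fix g h :: "'a vec" assume "g \<in> heis m" "h \<in> heis m"
  then show "ebar m i k (g + h) = ebar m i k g + ebar m i k h + 0 g h"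
    by (simp add: ebar_def square_add vec.scale_left_distrib)
next
  fix s and g :: "'a vec" assume "g \<in> heis m"
  then show "ebar m i k (vscale s g) = vscale (s\<^sup>2) (ebar m i k g)"
    by (simp add: ebar_def) (simp add: vscale_def power_mult_distrib)
qed (use assms in \<open>simp_all add: ebar_def\<close>)

lemma cocycle_rC2:
  assumes "t \<in> cocycle_index m"
  shows "cocycle m t \<in> (C2 m :: 'a cochain2 set)"
    "compatible m (cocycle m t) (cocycle_square m t :: 'a vec \<Rightarrow> 'a vec)"
proof -
  obtain p x y where t: "t = (p, x, y)" by (cases t)
  note range = cocycle_index_range[OF assms[unfolded t]]
  show "cocycle m t \<in> (C2 m :: 'a cochain2 set)"
    using range
    by (auto simp: t cocycle_def intro!: basic_cochain_C2 cochain2.subspace_add[OF C2_subspace])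
  have "compatible m (basic_cochain m x y x + 0) (basic_square m x y x + ebar m x (prm m y) :: 'a vec \<Rightarrow> 'a vec)"
    using range prm_range[of y m] by (intro compatible_add compatible_basic compatible_ebar) auto
  then show "compatible m (cocycle m t) (cocycle_square m t :: 'a vec \<Rightarrow> 'a vec)"
    using range
    by (auto simp: t cocycle_def cocycle_square_def intro!: compatible_add compatible_basic)
qed

lemma basic_cochain_center:
  assumes "a \<le> 2*m" "b \<le> 2*m"
  shows "basic_cochain m a b c (vscale s center) h = 0" "basic_cochain m a b c h (vscale s center) = (0 :: 'a vec)"
  using assms by (auto simp: basic_cochain_def ecoch_def evec_def vscale_def)

lemma br_basic_cochain:
  assumes "1 \<le> c" "c \<le> 2*m" "g \<in> heis m" "h \<in> heis m"
  shows "br m k (basic_cochain m a b c g h) = vscale (k c * (g a * h b + g b * h a) :: 'a) center"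
  using assms prm_range[of c m]
  by (simp add: basic_cochain_def ecoch_def br_eq sform_evec prm_prm mult.commute)

lemma br_basic_square:
  assumes "1 \<le> c" "c \<le> 2*m" "g \<in> heis m"
  shows "br m k (basic_square m a b c g) = vscale (k c * g a * g b :: 'a) center"
  using assms prm_range[of c m]
  by (simp add: basic_square_def br_eq sform_evec prm_prm mult_ac)

lemma br_ebar:
  assumes "1 \<le> c" "c \<le> 2*m" "g \<in> heis m"
  shows "br m k (ebar m i (prm m c) g) = vscale (k c * (g i)\<^sup>2 :: 'a) center"
  using assms prm_range[of c m]
  by (simp add: ebar_def br_eq sform_evec prm_prm mult_ac)

lemma cocycle_center:
  assumes "t \<in> cocycle_index m"
  shows "cocycle m t (br m g k) h = 0" "cocycle m t h (br m g k) = (0 :: 'a vec)"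
    "cocycle m t h (pmap m lam g) = 0" "cocycle m t h center = 0"
proof -
  obtain p x y where t: "t = (p, x, y)" by (cases t)
  note range = cocycle_index_range[OF assms[unfolded t]]
  show "cocycle m t (br m g k) h = 0" "cocycle m t h (br m g k) = (0 :: 'a vec)"
    "cocycle m t h (pmap m lam g) = 0" "cocycle m t h center = 0"
    using range basic_cochain_center[where s = 1]
    by (auto simp: t cocycle_def br_eq pmap_def basic_cochain_center)
qed

text \<open>
  The contribution of \<open>basic_cochain m a b c\<close> is a determinant in the coordinates \<open>a, b, c\<close>. It
  vanishes if \<open>c = a\<close>, and the two determinants of a triple with pivot cancel.
\<close>

lemma cocycle_Z2:
  assumes "t \<in> cocycle_index m"
  shows "cocycle m t \<in> (Z2 m :: 'a cochain2 set)"
proof -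
  obtain p x y where t: "t = (p, x, y)" by (cases t)
  note range = cocycle_index_range[OF assms[unfolded t]]
  have "d2 m (cocycle m t) g h k = (0 :: 'a vec)" for g h k
  proof (cases "g \<in> heis m \<and> h \<in> heis m \<and> k \<in> heis m")
    case True
    then have "d2 m (cocycle m t) g h k
        = br m g (cocycle m t h k) + br m h (cocycle m t g k) + br m k (cocycle m t g h)"
      using assms by (simp add: d2_def cocycle_center)
    also have "\<dots> = 0"
      using True range
      by (simp add: t cocycle_def br_basic_cochain vec.scale_left_distrib[symmetric] distrib_left add_ac mult_ac)
    finally show ?thesis .
  qed (auto simp: d2_def)
  then show ?thesis using cocycle_rC2(1)[OF assms] by (auto simp: Z2_def fun_eq_iff)
qed

text \<open>
  For \<open>p = x\<close> the square term \<open>ebar\<close> is needed: \<open>[h, \<phi>(h, g)]\<close> contains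
  \<open>h\<^sub>x\<^sup>2 g\<^sub>y z\<close>, which only \<open>[g, h\<^sub>x\<^sup>2 e\<^sub>y\<^sub>']\<close> cancels.
\<close>

lemma rcocycle_rZ2:
  assumes "t \<in> cocycle_index m"
  shows "rcocycle m t \<in> rZ2 m lam"
proof -
  obtain p x y where t: "t = (p, x, y)" by (cases t)
  note range = cocycle_index_range[OF assms[unfolded t]]
  have "ind2 m lam (cocycle m t, cocycle_square m t) g h = 0" for g h
  proof (cases "g \<in> heis m \<and> h \<in> heis m")
    case True
    then have "ind2 m lam (cocycle m t, cocycle_square m t) g h
        = br m g (cocycle_square m t h) + br m h (cocycle m t h g)"
      using assms by (simp add: ind2_def cocycle_center)
    also have "\<dots> = 0"
      using True range
      by (simp add: t cocycle_def cocycle_square_def br_basic_cochain br_basic_square br_ebar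
          vec.scale_left_distrib[symmetric] distrib_left add_ac mult_ac power2_eq_square)
    finally show ?thesis .
  qed (auto simp: ind2_def)
  then show ?thesis
    using cocycle_Z2[OF assms] cocycle_rC2(2)[OF assms]
    by (auto simp: rcocycle_def rZ2_iff fun_eq_iff)
qed

lemma ebar_center_rZ2: "(0, ebar m (2*m+1) (2*m+1)) \<in> rZ2 m lam"
proof -
  have "ind2 m lam (0, ebar m (2*m+1) (2*m+1)) = 0"
    by (intro ext) (simp add: ind2_def ebar_def)
  then show ?thesis
    using compatible_ebar[of "2*m+1" "2*m+1"] cochain2.subspace_0[OF Z2_subspace, of m]
    by (simp add: rZ2_iff)
qed

lemma basic_cochain_evec:
  assumes "1 \<le> x" "x \<le> 2*m" "1 \<le> c" "c \<le> 2*m" "1 \<le> p" "p \<le> 2*m" "1 \<le> y" "y \<le> 2*m"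
    "a \<noteq> b" "p \<noteq> y"
  shows "basic_cochain m a b c (evec p) (evec y) (prm m x)
    = (if {a, b} = {p, y} \<and> c = x then 1 else 0 :: 'a)"
proof -
  have "basic_cochain m a b c (evec p) (evec y) (prm m x)
    = ((evec p a * evec y b - evec y a * evec p b) * evec (prm m c) (prm m x) :: 'a)"
    using assms by (simp add: basic_cochain_def ecoch_def vscale_def mult.commute)
  also have "\<dots> = (if {a, b} = {p, y} \<and> c = x then 1 else 0)"
    using assms by (auto simp: evec_def prm_eq_iff doubleton_eq_iff)
  finally show ?thesis .
qed

text \<open>
  A cocycle with pivot has exactly two coefficients, one of them at the pivot of its three-element
  set. Coordinates never look at pivot positions, and the other position determines the triple since the
  pivot is unique.
\<close>

lemma coord_cocycle:
  assumes s: "s \<in> cocycle_index m" and t: "t \<in> cocycle_index m"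
  shows "coord m s (cocycle m t) = (if s = t then 1 else 0 :: 'a)"
proof -
  obtain p x y where s_eq: "s = (p, x, y)" by (cases s)
  obtain q u w where t_eq: "t = (q, u, w)" by (cases t)
  note range = cocycle_index_range[OF s[unfolded s_eq]] cocycle_index_range[OF t[unfolded t_eq]]
  have "coord m s (cocycle m t) = (cocycle m t (evec p) (evec y) (prm m x) :: 'a)"
    using cocycle_center(4)[OF t] by (simp add: s_eq coord_def)
  also have "\<dots> = (if q = u then if {u, w} = {p, y} \<and> u = x then 1 else 0
      else (if {q, w} = {p, y} \<and> u = x then 1 else 0) + (if {u, w} = {p, y} \<and> q = x then 1 else 0))"
    using range by (simp add: t_eq cocycle_def basic_cochain_evec)
  also have "\<dots> = (if s = t then 1 else 0)"
  proof (cases "p = x")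
    case True
    have "\<not> ({q, w} = {x, y} \<and> u = x)" "\<not> ({u, w} = {x, y} \<and> q = x)" if "q \<noteq> u"
      using that t by (auto simp: t_eq cocycle_index_def doubleton_eq_iff pivot_def)
    then show ?thesis using True range by (auto simp: s_eq t_eq doubleton_eq_iff)
  next
    case False
    then have pxy: "pivot m p x y" using s by (auto simp: s_eq cocycle_index_def)
    then have "\<not> pivot m x p y" "\<not> pivot m x y p" "\<not> pivot m y x p"
      using pivot_unique[OF pxy] pivot_unique[of m p y x] by (auto simp: pivot_commute)
    moreover have "pivot m q u w" if "q \<noteq> u" using t that by (auto simp: t_eq cocycle_index_def)
    ultimately have "\<not> ({u, w} = {p, y} \<and> q = x)" "{q, w} = {p, y} \<and> u = x \<longleftrightarrow> q = p \<and> u = x \<and> w = y"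
      if "q \<noteq> u"
      using that by (auto simp: doubleton_eq_iff)
    moreover have "\<not> ({u, w} = {p, y} \<and> u = x)"
      using pivot_range[OF pxy] by (auto simp: doubleton_eq_iff)
    ultimately show ?thesis using False by (auto simp: s_eq t_eq)
  qed
  finally show ?thesis .
qed

text \<open>
  Two compatible maps for the same \<open>\<phi>\<close> differ by an additive map, which is determined by its values on
  multiples of the basis vectors.
\<close>

lemma tilde_eq:
  assumes "compatible m \<phi> (\<omega> :: 'a vec \<Rightarrow> 'a vec)"
    and "\<And>i. 1 \<le> i \<Longrightarrow> i \<le> 2*m+1 \<Longrightarrow> \<omega> (evec i) = 0"
  shows "tilde m \<phi> = \<omega>"
  unfolding tilde_def
proof (rule the_equality)
  show "compatible m \<phi> \<omega> \<and> (\<forall>i\<in>{1..2*m+1}. \<omega> (evec i) = 0)" using assms by auto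
  fix \<omega>' :: "'a vec \<Rightarrow> 'a vec"
  assume \<omega>': "compatible m \<phi> \<omega>' \<and> (\<forall>i\<in>{1..2*m+1}. \<omega>' (evec i) = 0)"
  note D = compatible_D[OF assms(1)] and D' = compatible_D[OF \<omega>'[THEN conjunct1]]
  have "\<omega>' g - \<omega> g = 0" if "g \<in> heis m" for g
    by (rule additive_on_heis_eq_0[of m "\<lambda>g. \<omega>' g - \<omega> g"])
      (use that D(3,4) D'(3,4) assms(2) \<omega>' in \<open>auto simp: add_ac\<close>)
  then have "\<omega>' g = \<omega> g" if "g \<in> heis m" for g
    using that by (simp only: right_minus_eq)
  then show "\<omega>' = \<omega>" using D(2) D'(2) by (metis ext)
qed

lemma basic_square_evec: "a \<noteq> b \<Longrightarrow> basic_square m a b c (evec i) = (0 :: 'a vec)"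
  by (auto simp: basic_square_def evec_def)

lemma tilde_basic:
  assumes "1 \<le> c" "c \<le> 2*m" "a \<noteq> b"
  shows "tilde m (basic_cochain m a b c) = (basic_square m a b c :: 'a vec \<Rightarrow> 'a vec)"
  using assms by (intro tilde_eq compatible_basic basic_square_evec)

lemma tilde_basic_add:
  assumes "1 \<le> c" "c \<le> 2*m" "a \<noteq> b" "1 \<le> c'" "c' \<le> 2*m" "a' \<noteq> b'"
  shows "tilde m (basic_cochain m a b c + basic_cochain m a' b' c')
    = (basic_square m a b c + basic_square m a' b' c' :: 'a vec \<Rightarrow> 'a vec)"
  using assms by (intro tilde_eq compatible_add compatible_basic) (simp_all add: basic_square_evec)

end

section \<open>Matching the listed families with the index set\<close>

context heisenberg_char2
begin

lemma cochain2_diff_eq: "(\<phi> :: 'a cochain2) - \<phi>' = \<phi> + \<phi>'"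
  by (intro ext) simp

lemma cocycle_diagonal: "ecoch m x y (prm m x) = (cocycle m (x, x, y) :: 'a cochain2)"
  by (simp add: cocycle_def basic_cochain_def)

lemma cocycle_pivot:
  "p \<noteq> x \<Longrightarrow> cocycle m (p, x, y) = (ecoch m p y (prm m x) + ecoch m x y (prm m p) :: 'a cochain2)"
  by (simp add: cocycle_def basic_cochain_def)

lemma ecoch_commute: "ecoch m a b k = (ecoch m b a k :: 'a cochain2)"
  by (intro ext) (simp add: ecoch_def add.commute mult.commute)

text \<open>
  In \<open>A2\<close> the pivot is \<open>i\<close> and the conjugate pair is \<open>{j, j'}\<close>.
\<close>

lemma A2_pivot:
  "A2 m = (cocycle m ` {(p, x, y). pivot m p x y \<and> y = prm m x} :: 'a cochain2 set)" (is "?L = ?R")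
proof
  have "ecoch m i (prm m j) (prm m j) + ecoch m j (prm m j) (prm m i) = (cocycle m (i, j, prm m j) :: 'a cochain2)"
    "ecoch m i j j + ecoch m j (prm m j) (prm m i) = (cocycle m (i, prm m j, j) :: 'a cochain2)"
    "pivot m i j (prm m j)" "pivot m i (prm m j) j" "j = prm m (prm m j)"
    if "i \<noteq> j" "same_half m {i, j}" for i j
  proof -
    have j: "1 \<le> j" "j \<le> 2*m" and i: "1 \<le> i" "i \<le> 2*m" and half: "i \<le> m \<longleftrightarrow> j \<le> m"
      using that(2) by (auto simp: same_half_def)
    note j' = prm_prm[OF j] prm_half[OF j] prm_range[OF j]
    have ne: "i \<noteq> prm m j" "j \<noteq> prm m j" using half j' by auto
    show "ecoch m i (prm m j) (prm m j) + ecoch m j (prm m j) (prm m i) = (cocycle m (i, j, prm m j) :: 'a cochain2)"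
      using that by (simp add: cocycle_pivot)
    show "ecoch m i j j + ecoch m j (prm m j) (prm m i) = (cocycle m (i, prm m j, j) :: 'a cochain2)"
      using ne j' by (simp add: cocycle_pivot ecoch_commute[of j "prm m j"])
    show "pivot m i j (prm m j)" "pivot m i (prm m j) j" "j = prm m (prm m j)"
      using that i j j' ne by (auto simp: pivot_def)
  qed
  then show "?L \<subseteq> ?R" unfolding A2_def by (auto intro!: image_eqI)
  show "?R \<subseteq> ?L"
  proof (clarify)
    fix p x assume piv: "pivot m p x (prm m x)"
    note range = pivot_range[OF piv]
    note x' = prm_prm[OF range(3,4)] prm_half[OF range(3,4)]
    show "cocycle m (p, x, prm m x) \<in> ?L"
    proof (cases "p \<le> m \<longleftrightarrow> x \<le> m")
      case True
      then have "same_half m {p, x}" using range by (auto simp: same_half_def)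
      then show ?thesis unfolding A2_def using range by (auto simp: cocycle_pivot)
    next
      case False
      then have "same_half m {p, prm m x}" using range x'(2) by (auto simp: same_half_def)
      moreover have "cocycle m (p, x, prm m x) = (ecoch m p (prm m x) (prm m (prm m (prm m x)))
          + ecoch m (prm m x) (prm m (prm m x)) (prm m p) :: 'a cochain2)"
        using range x'(1) by (simp add: cocycle_pivot ecoch_commute[of x])
      ultimately show ?thesis unfolding A2_def using range x'(1) 
        by (intro UnI2 CollectI exI[of _ p] exI[of _ "prm m x"]) simp
    qed
  qed
qed

text \<open>
  In \<open>A3\<close> the pivot is \<open>k\<close>.
\<close>

lemma A3_pivot:
  "A3 m = (cocycle m ` {(p, x, y). pivot m p x y \<and> same_half m {p, x, y}} :: 'a cochain2 set)" (is "?L = ?R")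
proof
  have eq: "ecoch m k j (prm m i) + ecoch m i j (prm m k) = (cocycle m (k, i, j) :: 'a cochain2)"
    "ecoch m k i (prm m j) - ecoch m i j (prm m k) = (cocycle m (k, j, i) :: 'a cochain2)"
    if "k \<noteq> i" "k \<noteq> j" for i j k
    using that ecoch_commute[of i j "prm m k"]
    by (simp_all only: cocycle_pivot cochain2_diff_eq not_False_eq_True)
  have "pivot m k i j" "pivot m k j i" "same_half m {k, i, j}" "same_half m {k, j, i}"
    if "1 \<le> k \<and> k < i \<and> i < j \<and> j \<le> m \<or> m + 1 \<le> i \<and> i < j \<and> j < k \<and> k \<le> 2*m" for i j k
  proof -
    have range: "k \<noteq> i" "k \<noteq> j" "i \<noteq> j" "{k, i, j} \<subseteq> {1..2*m}"
      and ext: "if k \<le> m then k < i \<and> k < j else i < k \<and> j < k"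
      using that by auto
    show half: "same_half m {k, i, j}" "same_half m {k, j, i}"
      using that by (auto simp: same_half_iff)
    show "pivot m k i j" using range ext half unfolding pivot_def by blast
    then show "pivot m k j i" by (simp add: pivot_commute)
  qed
  then show "?L \<subseteq> ?R" unfolding A3_def by (auto simp: eq intro!: image_eqI)
  show "?R \<subseteq> ?L"
  proof (clarify)
    fix p x y assume piv: "pivot m p x y" and half: "same_half m {p, x, y}"
    note range = pivot_range[OF piv]
    have xy: "(p \<le> m \<longleftrightarrow> x \<le> m) \<and> (p \<le> m \<longleftrightarrow> y \<le> m)"
      using half unfolding same_half_iff by blast
    then have "if p \<le> m then p < x \<and> p < y else x < p \<and> y < p"
      using pivot_cases[OF piv] pivot_cases[OF piv[unfolded pivot_commute[of m p x y]]]
        prm_half[OF range(3,4)] prm_half[OF range(5,6)]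
      by (auto split: if_splits)
    then have ord: "1 \<le> p \<and> p < i \<and> i < j \<and> j \<le> m \<or> m + 1 \<le> i \<and> i < j \<and> j < p \<and> p \<le> 2*m"
      if "{i, j} = {x, y}" "i < j" for i j
      using that xy range by (auto simp: doubleton_eq_iff split: if_splits)
    show "cocycle m (p, x, y) \<in> ?L"
    proof (cases "x < y")
      case True
      then show ?thesis
        unfolding A3_def using ord[of x y] range
        by (intro UnI1 CollectI exI[of _ x] exI[of _ y] exI[of _ p]) (simp add: eq)
    next
      case False
      then have "y < x" using range by simp
      then show ?thesis
        unfolding A3_def using ord[of y x] range
        by (intro UnI2 CollectI exI[of _ x] exI[of _ y] exI[of _ p]) (auto simp: eq)
    qed
  qed
qed

text \<open>
  In \<open>A4\<close> the pivot is \<open>k'\<close>, which lies in the half that contains neither \<open>i\<close> nor \<open>j\<close>.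
\<close>

lemma A4_pivot:
  "A4 m = (cocycle m ` {(p, x, y). pivot m p x y \<and> y \<noteq> prm m x \<and> \<not> same_half m {p, x, y}} :: 'a cochain2 set)"
  (is "?L = ?R")
proof
  have eq: "ecoch m i (prm m k) (prm m j) - ecoch m i j k = (cocycle m (prm m k, j, i) :: 'a cochain2)"
    "ecoch m j (prm m k) (prm m i) + ecoch m i j k = (cocycle m (prm m k, i, j) :: 'a cochain2)"
    if "k \<noteq> i" "k \<noteq> j" "same_half m {i, j, k}" for i j k
  proof -
    have k: "1 \<le> k" "k \<le> 2*m" and half: "i \<le> m \<longleftrightarrow> k \<le> m" "j \<le> m \<longleftrightarrow> k \<le> m"
      using that(3) by (auto simp: same_half_def)
    have "prm m k \<noteq> i" "prm m k \<noteq> j" "prm m (prm m k) = k"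
      using half prm_half[OF k] prm_prm[OF k] by auto
    then show "ecoch m i (prm m k) (prm m j) - ecoch m i j k = (cocycle m (prm m k, j, i) :: 'a cochain2)"
      "ecoch m j (prm m k) (prm m i) + ecoch m i j k = (cocycle m (prm m k, i, j) :: 'a cochain2)"
      by (simp_all add: cocycle_pivot cochain2_diff_eq ecoch_commute[of "prm m k"] ecoch_commute[of j i])
  qed
  have piv: "pivot m (prm m k) i j \<and> j \<noteq> prm m i \<and> \<not> same_half m {prm m k, i, j}"
    if "k \<noteq> i" "k \<noteq> j" "i \<noteq> j" "same_half m {i, j, k}" for i j k
  proof -
    have k: "1 \<le> k" "k \<le> 2*m" and i: "1 \<le> i" "i \<le> 2*m" and j: "1 \<le> j" "j \<le> 2*m"
      and half: "i \<le> m \<longleftrightarrow> k \<le> m" "j \<le> m \<longleftrightarrow> k \<le> m"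
      using that(4) by (auto simp: same_half_def)
    note k' = prm_half[OF k] prm_prm[OF k] prm_range[OF k]
    have "prm m k \<noteq> i" "prm m k \<noteq> j" "j \<noteq> prm m i"
      using half k' prm_half[OF i] by auto
    moreover have "same_half m {prm m (prm m k), i, j}" "\<not> same_half m {prm m k, i, j}"
      using that(4) half k' i by (simp_all add: same_half_iff)
    ultimately show ?thesis using that i j k' by (simp add: pivot_def)
  qed
  show "?L \<subseteq> ?R"
  proof
    fix \<phi> :: "'a cochain2" assume "\<phi> \<in> A4 m"
    then obtain i j k where ijk: "k \<noteq> i" "k \<noteq> j" "i \<noteq> j" "same_half m {i, j, k}"
      and "\<phi> = ecoch m i (prm m k) (prm m j) - ecoch m i j k \<or>
        \<phi> = ecoch m j (prm m k) (prm m i) + ecoch m i j k"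
      unfolding A4_def by blast
    then have "\<phi> = cocycle m (prm m k, j, i) \<or> \<phi> = cocycle m (prm m k, i, j)"
      using eq by simp
    moreover have "same_half m {j, i, k}" using ijk(4) by (simp add: insert_commute)
    ultimately show "\<phi> \<in> ?R" using piv[of k i j] piv[of k j i] ijk by blast
  qed
  show "?R \<subseteq> ?L"
  proof (clarify)
    fix p x y assume pxy: "pivot m p x y" "y \<noteq> prm m x" "\<not> same_half m {p, x, y}"
    note range = pivot_range[OF pxy(1)]
    have sh: "same_half m {x, y, prm m p}" "same_half m {y, x, prm m p}" "prm m p \<noteq> x" "prm m p \<noteq> y"
      using pxy by (auto simp: pivot_def insert_commute)
    note p' = prm_prm[OF range(1,2)]
    show "cocycle m (p, x, y) \<in> ?L"
    proof (cases "x < y")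
      case True
      then show ?thesis
        unfolding A4_def using sh eq(2)[OF sh(3,4,1)] p'
        by (intro UnI2 CollectI exI[of _ x] exI[of _ y] exI[of _ "prm m p"]) simp
    next
      case False
      then have "y < x" using range by simp
      then show ?thesis
        unfolding A4_def using sh eq(1)[OF sh(4,3,2)] p'
        by (intro UnI1 CollectI exI[of _ y] exI[of _ x] exI[of _ "prm m p"]) simp
    qed
  qed
qed

text \<open>
  Removing \<open>A1\<close> from the union loses no element of the other families, because the coordinates
  separate cocycles with different indices.
\<close>

lemma A_set_minus_A1:
  "A_set m - A1 m = (cocycle m ` {(p, x, y). pivot m p x y} :: 'a cochain2 set)"
proof -
  have "cocycle m s \<noteq> (cocycle m t :: 'a cochain2)"
    if "s \<in> cocycle_index m" "t \<in> cocycle_index m" "s \<noteq> t" for s t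
    using coord_cocycle[OF that(1,1)] coord_cocycle[OF that(1,2)] that(3) by auto
  moreover have "\<phi> \<in> cocycle m ` {(x, x, y) | x y. x \<noteq> y \<and> {x, y} \<subseteq> {1..2*m}}"
    if \<phi>: "\<phi> \<in> A1 m" for \<phi> :: "'a cochain2"
  proof -
    obtain i j where "1 \<le> i" "i < j" "j \<le> 2*m"
      and "\<phi> = ecoch m i j (prm m i) \<or> \<phi> = ecoch m i j (prm m j)"
      using \<phi> unfolding A1_def by blast
    then have "\<phi> = cocycle m (i, i, j) \<or> \<phi> = cocycle m (j, j, i)"
      using cocycle_diagonal[of i j] cocycle_diagonal[of j i] ecoch_commute[of i j "prm m j"] by simp
    then show ?thesis using \<open>1 \<le> i\<close> \<open>i < j\<close> \<open>j \<le> 2*m\<close> by (auto intro!: imageI)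
  qed
  moreover have "s \<in> cocycle_index m \<and> t \<in> cocycle_index m \<and> s \<noteq> t"
    if "s \<in> {(x, x, y) | x y. x \<noteq> y \<and> {x, y} \<subseteq> {1..2*m}}" "t \<in> {(p, x, y). pivot m p x y}" for s t
    using that by (auto simp: cocycle_index_def dest: pivot_range(7))
  ultimately have "A1 m \<inter> cocycle m ` {(p, x, y). pivot m p x y} = ({} :: 'a cochain2 set)"
    by blast
  moreover have "A2 m \<union> A3 m \<union> A4 m = (cocycle m ` {(p, x, y). pivot m p x y} :: 'a cochain2 set)"
    unfolding A2_pivot A3_pivot A4_pivot image_Un[symmetric] by (rule arg_cong[where f = "image _"]) auto
  ultimately show ?thesis by (auto simp: A_set_def)
qed

lemma A_restr_eq: "A_restr m = (rcocycle m ` cocycle_index m :: 'a rcochain2 set)"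
proof -
  have diag: "(ecoch m x y (prm m x), tilde m (ecoch m x y (prm m x)) + ebar m x (prm m y))
      = (rcocycle m (x, x, y) :: 'a rcochain2)" if "1 \<le> x" "x \<le> 2*m" "x \<noteq> y" for x y
    using tilde_basic[of x x y] that
    by (simp add: rcocycle_def cocycle_def cocycle_square_def basic_cochain_def)
  have "tilde m (cocycle m (p, x, y)) = (cocycle_square m (p, x, y) :: 'a vec \<Rightarrow> 'a vec)"
    if "pivot m p x y" for p x y
    using pivot_range[OF that] by (simp add: cocycle_def cocycle_square_def tilde_basic_add)
  then have pivot: "{(\<phi>, tilde m \<phi>) | \<phi>. \<phi> \<in> A_set m - A1 m}
      = (rcocycle m ` {(p, x, y). pivot m p x y} :: 'a rcochain2 set)"
    unfolding A_set_minus_A1 by (force simp: rcocycle_def)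
  have "{(ecoch m i j (prm m i), tilde m (ecoch m i j (prm m i)) + ebar m i (prm m j)) | i j.
        1 \<le> i \<and> i < j \<and> j \<le> 2*m} \<union>
     {(ecoch m i j (prm m j), tilde m (ecoch m i j (prm m j)) + ebar m j (prm m i)) | i j.
        1 \<le> i \<and> i < j \<and> j \<le> 2*m}
     = (rcocycle m ` {(x, x, y) | x y. x \<noteq> y \<and> {x, y} \<subseteq> {1..2*m}} :: 'a rcochain2 set)" (is "?L1 \<union> ?L2 = ?R")
  proof
    show "?L1 \<union> ?L2 \<subseteq> ?R"
    proof
      fix s assume "s \<in> ?L1 \<union> ?L2"
      then obtain i j where ij: "1 \<le> i" "i < j" "j \<le> 2*m"
        and "s = (ecoch m i j (prm m i), tilde m (ecoch m i j (prm m i)) + ebar m i (prm m j)) \<or>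
          s = (ecoch m i j (prm m j), tilde m (ecoch m i j (prm m j)) + ebar m j (prm m i))"
        by blast
      then have "s = rcocycle m (i, i, j) \<or> s = rcocycle m (j, j, i)"
        using diag[of i j] diag[of j i] by (simp add: ecoch_commute[of j i])
      then show "s \<in> ?R" using ij by (auto intro!: imageI)
    qed
    show "?R \<subseteq> ?L1 \<union> ?L2"
    proof
      fix s assume "s \<in> ?R"
      then obtain x y where xy: "1 \<le> x" "x \<le> 2*m" "1 \<le> y" "y \<le> 2*m" "x \<noteq> y"
        and s: "s = rcocycle m (x, x, y)"
        by auto
      have s': "s = (ecoch m x y (prm m x), tilde m (ecoch m x y (prm m x)) + ebar m x (prm m y))"
        using s diag[OF xy(1,2,5)] by simp
      show "s \<in> ?L1 \<union> ?L2"
      proof (cases "x < y")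
        case True
        then show ?thesis using s' xy by blast
      next
        case False
        then have "y < x" using xy by simp
        then show ?thesis using s' xy unfolding ecoch_commute[of x y] by blast
      qed
    qed
  qed
  then show ?thesis
    unfolding A_restr_def pivot cocycle_index_def image_Un by (rule arg_cong2[where f = "(\<union>)"]) auto
qed

section \<open>The second restricted cohomology\<close>

lemma rcocycle_center: "t \<in> cocycle_index m \<Longrightarrow> snd (rcocycle m t) center = (0 :: 'a vec)"
proof -
  assume t: "t \<in> cocycle_index m"
  obtain p x y where t_eq: "t = (p, x, y)" by (cases t)
  show ?thesis
    using cocycle_index_range[OF t[unfolded t_eq]]
    by (simp add: t_eq rcocycle_def cocycle_square_def basic_square_def ebar_def) (simp add: evec_def)
qed

lemma fst_rcocycle: "fst (rcocycle m t) = cocycle m t"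
  by (simp add: rcocycle_def)

lemma fst_rscale2: "fst (rscale2 a x) = scale2 a (fst x)"
  by (cases x) (simp add: rscale2_def)

lemma coord_rB2:
  assumes "t \<in> cocycle_index m" "b \<in> rB2 m lam"
  shows "coord m t (fst b) = 0"
  using assms(2) coord_d1[OF assms(1)] by (auto simp: rB2_def rd1_def)

lemma A_restr_basis:
  assumes "lam (2*m+1) \<noteq> 0"
  shows "classes_form_basis rscale2 (rZ2 m lam) (rB2 m lam) (A_restr m)"
  unfolding A_restr_eq
proof (rule rcochain2.classes_form_basis_from_coordinates
    [OF rZ2_subspace rB2_subspace finite_cocycle_index, where f = "\<lambda>t x. coord m t (fst x)"])
  show "z \<in> rB2 m lam" if "z \<in> rZ2 m lam" "\<And>t. t \<in> cocycle_index m \<Longrightarrow> coord m t (fst z) = 0" for z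
    using that assms restricted_coboundary_if_coord_0 by (cases z) auto
qed (simp_all add: rcocycle_rZ2 coord_add fst_rscale2 coord_scale coord_rB2 fst_rcocycle coord_cocycle)

text \<open>
  Every coboundary vanishes at \<open>z\<close>, as \<open>ind\<^sup>1 \<psi> (z) = \<psi>(z\<^sup>[\<^sup>2\<^sup>]) = 0\<close>. So the \<open>z\<close>-component of
  \<open>\<omega>(z)\<close> is a further coordinate, given by the index \<open>None\<close>.
\<close>

lemma A_restr_center_basis:
  assumes lam: "lam (2*m+1) = 0"
  shows "classes_form_basis rscale2 (rZ2 m lam) (rB2 m lam)
    (A_restr m \<union> {(0, ebar m (2*m+1) (2*m+1))})"
proof -
  define I where "I = insert None (Some ` cocycle_index m)"
  define f :: "(nat \<times> nat \<times> nat) option \<Rightarrow> 'a rcochain2 \<Rightarrow> 'a" where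
    "f i x = (case i of None \<Rightarrow> snd x center (Suc (2*m)) | Some t \<Rightarrow> coord m t (fst x))" for i x
  define rep :: "(nat \<times> nat \<times> nat) option \<Rightarrow> 'a rcochain2" where
    "rep = case_option (0, ebar m (2*m+1) (2*m+1)) (rcocycle m)"
  have "classes_form_basis rscale2 (rZ2 m lam) (rB2 m lam) (rep ` I)"
  proof (rule rcochain2.classes_form_basis_from_coordinates[OF rZ2_subspace rB2_subspace])
    show "finite I" by (simp add: I_def finite_cocycle_index)
    show "rep i \<in> rZ2 m lam" if "i \<in> I" for i
      using that ebar_center_rZ2 rcocycle_rZ2 by (auto simp: I_def rep_def)
    show "f i (x + y) = f i x + f i y" for i x y
      by (simp add: f_def coord_add split: option.split)
    show "f i (rscale2 a x) = a * f i x" for i a x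
      by (cases x) (simp add: f_def fst_rscale2 coord_scale rscale2_def scale1_def vscale_def
          split: option.split)
    show "f i (rep j) = (if i = j then 1 else 0)" if "i \<in> I" "j \<in> I" for i j
    proof -
      have "ebar m (Suc (2*m)) (Suc (2*m)) center (Suc (2*m)) = (1 :: 'a)"
        by (simp add: ebar_def) (simp add: vscale_def evec_def)
      moreover have "coord m t (0 :: 'a cochain2) = 0" for t by (cases t) (simp add: coord_def)
      ultimately show ?thesis
        using that
        by (cases i; cases j)
          (simp_all add: I_def f_def rep_def fst_rcocycle coord_cocycle rcocycle_center image_iff)
    qed
    show "f i b = 0" if i: "i \<in> I" and b: "b \<in> rB2 m lam" for i b
    proof (cases i)
      case None
      obtain \<psi> where \<psi>: "\<psi> \<in> C1 m" "b = rd1 m lam \<psi>" using b unfolding rB2_def by blast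
      then show ?thesis
        using None lam C1_D(5)[OF \<psi>(1)] pmap_evec[of "2*m+1"]
        by (simp add: f_def rd1_def ind1_def)
    qed (use i b in \<open>auto simp: f_def I_def intro: coord_rB2\<close>)
    show "z \<in> rB2 m lam" if "z \<in> rZ2 m lam" "\<And>i. i \<in> I \<Longrightarrow> f i z = 0" for z
    proof -
      have "coord m t (fst z) = 0" if "t \<in> cocycle_index m" for t
        using \<open>\<And>i. i \<in> I \<Longrightarrow> f i z = 0\<close>[of "Some t"] that by (simp add: I_def f_def)
      moreover have "snd z center (Suc (2*m)) = 0"
        using \<open>\<And>i. i \<in> I \<Longrightarrow> f i z = 0\<close>[of None] by (simp add: I_def f_def)
      ultimately show ?thesis
        using that(1) restricted_coboundary_if_coord_0 by (cases z) auto
    qed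
  qed
  moreover have "rep ` I = A_restr m \<union> {(0, ebar m (2*m+1) (2*m+1))}"
    by (simp add: I_def rep_def A_restr_eq image_image)
  ultimately show ?thesis by simp
qed

text \<open>
  A cocycle is, modulo a coboundary, a combination of the explicit cocycles by its coordinates. All of
  these have restricted lifts, and coboundaries lift through \<open>rd1\<close>.
\<close>

lemma Z2_lift:
  assumes \<phi>: "\<phi> \<in> Z2 m"
  obtains x where "x \<in> rZ2 m lam" "fst x = \<phi>"
proof -
  let ?s = "\<Sum>t\<in>cocycle_index m. rscale2 (coord m t \<phi>) (rcocycle m t)"
  have s: "?s \<in> rZ2 m lam"
    by (intro rcochain2.subspace_sum[OF rZ2_subspace] rcochain2.subspace_scale[OF rZ2_subspace] rcocycle_rZ2)
  have coord_0: "coord m u 0 = (0 :: 'a)" for u by (cases u) (simp add: coord_def)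
  have coord_sum: "coord m u (\<Sum>t\<in>T. F t) = (\<Sum>t\<in>T. coord m u (F t))"
    for u and T :: "(nat \<times> nat \<times> nat) set" and F :: "_ \<Rightarrow> 'a cochain2"
    by (induction T rule: infinite_finite_induct)
      (simp_all only: sum.infinite sum.empty sum.insert not_False_eq_True coord_0 coord_add)
  have "coord m u (fst ?s) = coord m u \<phi>" if u: "u \<in> cocycle_index m" for u
  proof -
    have "coord m u (fst ?s) = (\<Sum>t\<in>cocycle_index m. coord m t \<phi> * coord m u (cocycle m t))"
      by (simp add: fst_sum fst_rscale2 coord_sum coord_scale rcocycle_def)
    also have "\<dots> = (\<Sum>t\<in>cocycle_index m. if t = u then coord m u \<phi> else 0)"
      by (rule sum.cong) (auto simp: coord_cocycle u)
    finally show ?thesis using u finite_cocycle_index by simp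
  qed
  then have "coord m u (\<phi> - fst ?s) = 0" if "u \<in> cocycle_index m" for u
    using coord_add[of m u "\<phi> - fst ?s" "fst ?s"] that by simp
  moreover have "\<phi> - fst ?s \<in> Z2 m"
    using \<phi> s by (intro cochain2.subspace_diff[OF Z2_subspace]) (auto simp: rZ2_def Z2_def rC2_def rd2_def zero_prod_def)
  ultimately obtain \<psi> where \<psi>: "\<psi> \<in> C1 m" "d1 m \<psi> = \<phi> - fst ?s"
    using coboundary_if_coord_0 by blast
  show thesis
  proof (rule that)
    show "?s + rd1 m lam \<psi> \<in> rZ2 m lam"
      using s rd1_rZ2[OF \<psi>(1)] by (rule rcochain2.subspace_add[OF rZ2_subspace])
    show "fst (?s + rd1 m lam \<psi>) = \<phi>" by (simp add: rd1_def \<psi>(2))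
  qed
qed

text \<open>
  The isomorphism forgets \<open>\<omega>\<close>. It is injective because the coordinates depend on \<open>\<phi>\<close> only and, for
  \<open>\<lambda>\<^sub>2\<^sub>m\<^sub>+\<^sub>1 \<noteq> 0\<close>, vanish simultaneously only on restricted coboundaries.
\<close>

lemma rH2_isomorphic_H2:
  assumes "lam (2*m+1) \<noteq> 0"
  shows "linearly_isomorphic (rH2 m lam) (H2 m)"
  unfolding rH2_def H2_def
proof (rule linearly_isomorphic_quotients[where \<pi> = fst])
  show "fst ` rZ2 m lam = Z2 m"
  proof
    show "fst ` rZ2 m lam \<subseteq> Z2 m" by (auto simp: rZ2_iff)
    show "Z2 m \<subseteq> fst ` rZ2 m lam" using Z2_lift by (metis image_eqI subsetI)
  qed
  show "fst ` rB2 m lam = B2 m" by (auto simp: rB2_def B2_def rd1_def image_image)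
  show "x \<in> rB2 m lam" if "x \<in> rZ2 m lam" "fst x \<in> B2 m" for x
  proof -
    have "coord m t (fst x) = 0" if "t \<in> cocycle_index m" for t
      using coord_d1[OF that] \<open>fst x \<in> B2 m\<close> by (auto simp: B2_def)
    then show ?thesis
      using that(1) assms restricted_coboundary_if_coord_0 by (cases x) auto
  qed
qed (simp_all add: fst_rscale2 rcochain2.vector_space_axioms cochain2.vector_space_axioms
    rZ2_subspace rB2_subspace B2_subspace)

end

theorem proposition3p7:
  fixes m :: nat and lam :: "nat \<Rightarrow> 'a::alg_closed_field"
  assumes "m > 1" and "CHAR('a) = 2"
  shows
    "(lam (2*m+1) = 0 \<longrightarrow>
        classes_form_basis rscale2 (rZ2 m lam) (rB2 m lam)
          (A_restr m \<union> {(0, ebar m (2*m+1) (2*m+1))})) \<and>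
     (lam (2*m+1) \<noteq> 0 \<longrightarrow>
        linearly_isomorphic (rH2 m lam) (H2 m) \<and>
        classes_form_basis rscale2 (rZ2 m lam) (rB2 m lam) (A_restr m))"
proof -
  interpret heisenberg_char2 m lam by unfold_locales fact+
  show ?thesis using A_restr_center_basis A_restr_basis rH2_isomorphic_H2 by blast
qed

end
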